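(* Let $C\subset\mathbb{R}^n$ be a pointed closed convex cone with nonempty interior. Let $p,q\in\mathbb{R}$, $p\neq 0$, and let $\mu$ be a nonzero finite Borel measure defined on $\Omega_{C^\circ}$ whose support concentrates on a compact set $\omega\subset\Omega_{C^\circ}$. The following statements hold. (i) If $q\neq 0$ and $p\neq q$, then there exists a $C$-full set $\mathbb{A}$ such that $\mu=\widetilde{C}_{p,q}(\mathbb{A},\cdot)$. (ii) If $q=0$, then there exists a $C$-full set $\mathbb{A}$ such that $\mu=J^*_p(\mathbb{A},\cdot)$, where $J^*_p(\mathbb{A},\cdot)=\widetilde{C}_{p,0}(\mathbb{A},\cdot)$.
   Context: A pointed closed convex cone $C\subset\mathbb{R}^n$ is a closed convex set with $C=\{\lambda x:\lambda\ge 0,\ x\in C\}$, nonempty interior, and $C\cap(-C)=\{o\}$, where $o$ is the origin. Its polar cone is $C^\circ=\{x\in\mathbb{R}^n: x\cdot y\le 0\text{ for all }y\in C\}$. Put $\Omega_C=S^{n-1}\cap\operatorname{int}C$ and $\Omega_{C^\circ}=S^{n-1}\cap\operatorname{int}C^\circ$. For $u\in S^{n-1}$, $a\in\mathbb{R}$, let $H(u,a)=\{x: x\cdot u=a\}$ and $H^-(u,a)=\{x: x\cdot u\le a\}$. An unbounded closed convex set $\mathbb{A}\subset C$ with $o\notin\mathbb{A}$ is $C$-compatible if $\mathbb{A}$ equals the intersection of $C$ with all half-spaces $H^-(u,a)$, $u\in\Omega_{C^\circ}$, $a\in\mathbb{R}$, that contain $\mathbb{A}$. A $C$-full set is a $C$-compatible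 set $\mathbb{A}$ with $C\setminus\mathbb{A}$ bounded. For a $C$-compatible set $\mathbb{A}$: the support function is $h_C(\mathbb{A},u)=\sup\{x\cdot u:x\in\mathbb{A}\}\in(-\infty,0)$, $u\in\Omega_{C^\circ}$; the radial function is $\rho_C(\mathbb{A},v)=\sup\{r>0: rv\in C\setminus\mathbb{A}\}$, for $v\in\Omega_C$ (the same formula is used for $v\in C\cap S^{n-1}$). Let $\partial_e\mathbb{A}=\partial\mathbb{A}\cap\partial(C\setminus\mathbb{A})$ and $\Omega_C^e=\{x/|x|:x\in\partial_e\mathbb{A}\}\supseteq\Omega_C$ (the difference has spherical Lebesgue measure zero). For $\eta\subseteq\Omega_{C^\circ}$, the reverse radial Gauss image is $\boldsymbol{\alpha}^*_{\mathbb{A}}(\eta)=\{v\in\Omega_C^e:\rho_C(\mathbb{A},v)v\in H(u,h_C(\mathbb{A},u))\text{ for some }u\in\eta\}$. With $dv$ the spherical Lebesgue measure, the $q$-th dual curvature measure is, for Borel $\eta\subseteq\Omega_{C^\circ}$, $\widetilde{C}_q(\mathbb{A},\eta)=\frac1n\int_{\boldsymbol{\alpha}^*_{\mathbb{A}}(\eta)}\rho_C(\mathbb{A},v)^q\,dv$ if $q\ne0$, and $\widetilde{C}_0(\mathbb{A},\eta)=\int_{\boldsymbol{\alpha}^*_{\mathbb{A}}(\eta)}dv$. The $(p,q)$-th dual curvature measure is $\widetilde{C}_{p,q}(\mathbb{A},\eta)=\int_\eta(-h_C(\mathbb{A},u))^{-p}\,d\widetilde{C}_q(\mathbb{A},u)$,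 $\eta\subseteq\Omega_{C^\circ}$ Borel. *)

theory Defs
  imports "HOL-Analysis.Analysis"
begin

section \<open>Pointed closed convex cones and their polars\<close>

definition pointed_closed_convex_cone :: "'a::euclidean_space set \<Rightarrow> bool" where
  "pointed_closed_convex_cone C \<longleftrightarrow>
     closed C \<and> convex C \<and> cone C \<and> interior C \<noteq> {} \<and> C \<inter> uminus ` C = {0}"

definition polar_cone :: "'a::euclidean_space set \<Rightarrow> 'a set" where
  "polar_cone C = {x. \<forall>y\<in>C. x \<bullet> y \<le> 0}"

text \<open>With \<open>Omega C\<close> for the open spherical region of \<open>C\<close>, the region of the polar cone is
  \<open>Omega (polar_cone C)\<close>.\<close>

definition Omega :: "'a::euclidean_space set \<Rightarrow> 'a set" where
  "Omega C = sphere 0 1 \<inter> interior C"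

definition hyperplane :: "'a::euclidean_space \<Rightarrow> real \<Rightarrow> 'a set" where
  "hyperplane u a = {x. x \<bullet> u = a}"

definition lower_halfspace :: "'a::euclidean_space \<Rightarrow> real \<Rightarrow> 'a set" where
  "lower_halfspace u a = {x. x \<bullet> u \<le> a}"


section \<open>Compatible sets, full sets, and their support and radial functions\<close>

definition C_compatible :: "'a::euclidean_space set \<Rightarrow> 'a set \<Rightarrow> bool" where
  "C_compatible C A \<longleftrightarrow>
     \<not> bounded A \<and> closed A \<and> convex A \<and> A \<subseteq> C \<and> 0 \<notin> A \<and>
     A = C \<inter> \<Inter> {lower_halfspace u a | u a.
                    u \<in> Omega (polar_cone C) \<and> A \<subseteq> lower_halfspace u a}"

definition C_full :: "'a::euclidean_space set \<Rightarrow> 'a set \<Rightarrow> bool" where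
  "C_full C A \<longleftrightarrow> C_compatible C A \<and> bounded (C - A)"

text \<open>Both suprema below are real-valued, so they carry their usual meaning only where the set in
  question is nonempty and bounded above. For a \<open>C\<close>-compatible \<open>A\<close> this holds at the arguments
  at which they are used: \<open>u \<in> Omega (polar_cone C)\<close>, respectively \<open>v \<in> Omega_e C A\<close>
  (recall that \<open>x + C \<subseteq> A\<close> for every \<open>x \<in> A\<close>).\<close>

definition support_fun :: "'a::euclidean_space set \<Rightarrow> 'a \<Rightarrow> real" where
  "support_fun A u = (SUP x\<in>A. x \<bullet> u)"

definition radial_fun :: "'a::euclidean_space set \<Rightarrow> 'a set \<Rightarrow> 'a \<Rightarrow> real" where
  "radial_fun C A v = Sup {r. r > 0 \<and> r *\<^sub>R v \<in> C - A}"


section \<open>The reverse radial Gauss image\<close>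

definition effective_boundary :: "'a::euclidean_space set \<Rightarrow> 'a set \<Rightarrow> 'a set" where
  "effective_boundary C A = frontier A \<inter> frontier (C - A)"

definition Omega_e :: "'a::euclidean_space set \<Rightarrow> 'a set \<Rightarrow> 'a set" where
  "Omega_e C A = (\<lambda>x. x /\<^sub>R norm x) ` effective_boundary C A"

definition reverse_radial_Gauss_image ::
    "'a::euclidean_space set \<Rightarrow> 'a set \<Rightarrow> 'a set \<Rightarrow> 'a set" where
  "reverse_radial_Gauss_image C A \<eta> =
     {v \<in> Omega_e C A.
        \<exists>u\<in>\<eta>. radial_fun C A v *\<^sub>R v \<in> hyperplane u (support_fun A u)}"


section \<open>Spherical Lebesgue measure and the dual curvature measures\<close>

text \<open>By polar coordinates, the spherical Lebesgue measure of a Borel set \<open>\<eta>\<close> of unit vectors is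
  \<open>n\<close> times the volume of the cone \<open>{x. 0 < |x| \<le> 1, x/|x| \<in> \<eta>}\<close>. For \<open>n = 1\<close> this is the
  counting measure. The completion is taken because reverse radial Gauss images of Borel sets are
  in general only known to be measurable in the Lebesgue sense.\<close>

definition spherical_lebesgue :: "'a::euclidean_space measure" where
  "spherical_lebesgue =
     completion (scale_measure (of_nat DIM('a))
       (distr (restrict_space lborel (cball 0 1 - {0})) (restrict_space borel (sphere 0 1))
              (\<lambda>x. x /\<^sub>R norm x)))"

definition dual_curvature_fun ::
    "real \<Rightarrow> 'a::euclidean_space set \<Rightarrow> 'a set \<Rightarrow> 'a set \<Rightarrow> ennreal" where
  "dual_curvature_fun q C A \<eta> =
     (if q = 0
      then (\<integral>\<^sup>+ v\<in>reverse_radial_Gauss_image C A \<eta>. 1 \<partial>spherical_lebesgue)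
      else ennreal (1 / real DIM('a)) *
           (\<integral>\<^sup>+ v\<in>reverse_radial_Gauss_image C A \<eta>.
              ennreal (radial_fun C A v powr q) \<partial>spherical_lebesgue))"

definition dual_curvature_measure ::
    "real \<Rightarrow> 'a::euclidean_space set \<Rightarrow> 'a set \<Rightarrow> 'a measure" where
  "dual_curvature_measure q C A =
     measure_of (Omega (polar_cone C)) (sets (restrict_space borel (Omega (polar_cone C))))
       (dual_curvature_fun q C A)"

definition pq_dual_curvature_measure ::
    "real \<Rightarrow> real \<Rightarrow> 'a::euclidean_space set \<Rightarrow> 'a set \<Rightarrow> 'a measure" where
  "pq_dual_curvature_measure p q C A =
     density (dual_curvature_measure q C A) (\<lambda>u. ennreal ((- support_fun A u) powr (- p)))"

definition J_star :: "real \<Rightarrow> 'a::euclidean_space set \<Rightarrow> 'a set \<Rightarrow> 'a measure" where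
  "J_star p C A = pq_dual_curvature_measure p 0 C A"


section \<open>Support of a measure\<close>

definition measure_support :: "'a::topological_space measure \<Rightarrow> 'a set" where
  "measure_support \<mu> =
     {x \<in> space \<mu>. \<forall>U. open U \<longrightarrow> x \<in> U \<longrightarrow> emeasure \<mu> (U \<inter> space \<mu>) > 0}"

end

theory Submission
  imports Defs "HOL-Complex_Analysis.Great_Picard"
begin

text \<open>For a function \<open>\<phi>\<close> on \<open>\<omega>\<close>, the Wulff shape
  \<open>A = {x \<in> C. \<forall>u\<in>\<omega>. x \<bullet> u \<le> - exp (\<phi> u)}\<close> has the radial function
  \<open>ln \<rho>(v) = max\<^sub>u (\<phi> u - ln (- u \<bullet> v))\<close>, which is the conjugate of \<open>\<phi>\<close> for the cost
  \<open>ln (- u \<bullet> v)\<close>. Since \<open>\<omega>\<close> is a compact subset of the open polar region, this cost is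
  continuous on \<open>\<omega> \<times> (C \<inter> S)\<close>. Maximise the exponential mean of order \<open>p\<close> of \<open>\<phi>\<close> under
  \<open>\<mu>\<close> minus the exponential mean of order \<open>q\<close> of the conjugate under spherical Lebesgue
  measure. Both means are monotone and commute with the addition of constants, so passing to the
  biconjugate and normalising at one point does not decrease the functional; it therefore suffices
  to maximise over a compact (equicontinuous) class, whatever the signs of \<open>p\<close> and \<open>q\<close>.

  Almost every ray meets the boundary of \<open>A\<close> in a point with only one normal, because
  supergradients of a concave function are monotone along lines. So the conjugate can be
  differentiated in \<open>\<phi>\<close> and the Euler-Lagrange equation says that the two measures of the theorem
  are proportional. Adding a constant to \<open>\<phi>\<close> multiplies the quotient of the two sides by a power
  with exponent \<open>p - q \<noteq> 0\<close>, which makes them equal.\<close>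

section \<open>Exponential means\<close>

definition exp_mean :: "real \<Rightarrow> 'a measure \<Rightarrow> ('a \<Rightarrow> real) \<Rightarrow> real" where
  "exp_mean q M f =
     (if q = 0 then (\<integral>x. f x \<partial>M) / measure M (space M) else ln (\<integral>x. exp (q * f x) \<partial>M) / q)"

lemma exp_mean_cong: "(\<And>x. x \<in> space M \<Longrightarrow> f x = g x) \<Longrightarrow> exp_mean q M f = exp_mean q M g"
  unfolding exp_mean_def by (simp cong: Bochner_Integration.integral_cong)

lemma (in finite_measure) integrable_bounded:
  fixes f :: "'a \<Rightarrow> real"
  assumes "f \<in> borel_measurable M" "\<And>x. x \<in> space M \<Longrightarrow> \<bar>f x\<bar> \<le> B"
  shows "integrable M f"
  using assms by (intro integrable_const_bound[where B = B]) auto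

lemma abs_exp_mult_le:
  fixes q t B :: real
  assumes "\<bar>t\<bar> \<le> B"
  shows "exp (q * t) \<le> exp (\<bar>q\<bar> * B)"
proof -
  have "q * t \<le> \<bar>q\<bar> * \<bar>t\<bar>" by (metis abs_ge_self abs_mult)
  also have "\<dots> \<le> \<bar>q\<bar> * B" using assms by (intro mult_left_mono) auto
  finally show ?thesis by simp
qed

locale nonzero_finite_measure = finite_measure +
  assumes nonzero: "emeasure M (space M) \<noteq> 0"
begin

lemma measure_space_pos: "measure M (space M) > 0"
  using nonzero by (simp add: emeasure_eq_measure zero_less_measure_iff)

lemma integrable_exp:
  fixes f :: "'a \<Rightarrow> real"
  assumes "f \<in> borel_measurable M" "\<And>x. x \<in> space M \<Longrightarrow> \<bar>f x\<bar> \<le> B"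
  shows "integrable M (\<lambda>x. exp (q * f x))"
  by (rule integrable_bounded[where B = "exp (\<bar>q\<bar> * B)"]) (use assms abs_exp_mult_le in auto)

lemma integral_exp_pos:
  fixes f :: "'a \<Rightarrow> real"
  assumes "f \<in> borel_measurable M" "\<And>x. x \<in> space M \<Longrightarrow> \<bar>f x\<bar> \<le> B"
  shows "(\<integral>x. exp (q * f x) \<partial>M) > 0"
proof -
  have "0 < exp (- (\<bar>q\<bar> * B)) * measure M (space M)"
    using measure_space_pos by simp
  also have "\<dots> = (\<integral>x. exp (- (\<bar>q\<bar> * B)) \<partial>M)" by simp
  also have "\<dots> \<le> (\<integral>x. exp (q * f x) \<partial>M)"
  proof (rule integral_mono)
    show "integrable M (\<lambda>x. exp (q * f x))" using assms by (rule integrable_exp)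
    fix x assume "x \<in> space M"
    then have "exp ((- q) * f x) \<le> exp (\<bar>- q\<bar> * B)"
      using assms by (intro abs_exp_mult_le) auto
    then show "exp (- (\<bar>q\<bar> * B)) \<le> exp (q * f x)" by simp
  qed simp
  finally show ?thesis .
qed

text \<open>For q < 0 the exponential and the division by q both reverse the order, so monotonicity
  holds for either sign of q.\<close>

lemma exp_mean_mono:
  assumes f: "f \<in> borel_measurable M" "\<And>x. x \<in> space M \<Longrightarrow> \<bar>f x\<bar> \<le> B"
    and g: "g \<in> borel_measurable M" "\<And>x. x \<in> space M \<Longrightarrow> \<bar>g x\<bar> \<le> B'"
    and le: "\<And>x. x \<in> space M \<Longrightarrow> f x \<le> g x"
  shows "exp_mean q M f \<le> exp_mean q M g"
proof -
  note pos = integral_exp_pos[OF f, of q] integral_exp_pos[OF g, of q]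
  consider "q = 0" | "q > 0" | "q < 0" by linarith
  then show ?thesis
  proof cases
    case 1
    have "(\<integral>x. f x \<partial>M) \<le> (\<integral>x. g x \<partial>M)"
      using le by (intro integral_mono integrable_bounded[OF f] integrable_bounded[OF g]) auto
    then show ?thesis using 1 by (simp add: exp_mean_def divide_right_mono)
  next
    case 2
    then have "(\<integral>x. exp (q * f x) \<partial>M) \<le> (\<integral>x. exp (q * g x) \<partial>M)"
      using le by (intro integral_mono integrable_exp[OF f] integrable_exp[OF g]) auto
    then show ?thesis using 2 pos by (simp add: exp_mean_def divide_right_mono)
  next
    case 3
    then have "(\<integral>x. exp (q * g x) \<partial>M) \<le> (\<integral>x. exp (q * f x) \<partial>M)"
      using le by (intro integral_mono integrable_exp[OF f] integrable_exp[OF g]) auto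
    then show ?thesis using 3 pos by (simp add: exp_mean_def divide_right_mono_neg)
  qed
qed

lemma exp_mean_add_const:
  assumes f: "f \<in> borel_measurable M" "\<And>x. x \<in> space M \<Longrightarrow> \<bar>f x\<bar> \<le> B"
  shows "exp_mean q M (\<lambda>x. f x + c) = exp_mean q M f + c"
proof (cases "q = 0")
  case True
  have "integrable M f" using f by (rule integrable_bounded)
  then show ?thesis
    using True measure_space_pos by (simp add: exp_mean_def field_simps)
next
  case False
  have "(\<integral>x. exp (q * (f x + c)) \<partial>M) = exp (q * c) * (\<integral>x. exp (q * f x) \<partial>M)"
    by (simp add: exp_add ring_distribs mult.commute)
  then show ?thesis
    using False integral_exp_pos[OF f, of q]
    by (simp add: exp_mean_def ln_mult field_simps)
qed

text \<open>A monotone functional that commutes with adding constants is 1-Lipschitz in the uniform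
  distance: f <= g + d gives one half, exchanging f and g the other.\<close>

lemma exp_mean_dist_le:
  assumes f: "f \<in> borel_measurable M" "\<And>x. x \<in> space M \<Longrightarrow> \<bar>f x\<bar> \<le> B"
    and g: "g \<in> borel_measurable M" "\<And>x. x \<in> space M \<Longrightarrow> \<bar>g x\<bar> \<le> B'"
    and le: "\<And>x. x \<in> space M \<Longrightarrow> \<bar>f x - g x\<bar> \<le> d"
  shows "\<bar>exp_mean q M f - exp_mean q M g\<bar> \<le> d"
proof -
  have *: "exp_mean q M f \<le> exp_mean q M g + d"
    if f: "f \<in> borel_measurable M" "\<And>x. x \<in> space M \<Longrightarrow> \<bar>f x\<bar> \<le> B"
    and g: "g \<in> borel_measurable M" "\<And>x. x \<in> space M \<Longrightarrow> \<bar>g x\<bar> \<le> B'"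
    and le: "\<And>x. x \<in> space M \<Longrightarrow> \<bar>f x - g x\<bar> \<le> d" for f g B B'
  proof -
    have "exp_mean q M f \<le> exp_mean q M (\<lambda>x. g x + d)"
    proof (rule exp_mean_mono[OF f])
      show "(\<lambda>x. g x + d) \<in> borel_measurable M" using g by simp
      show "\<bar>g x + d\<bar> \<le> B' + \<bar>d\<bar>" if "x \<in> space M" for x using g(2)[OF that] by linarith
      show "f x \<le> g x + d" if "x \<in> space M" for x using le[OF that] by linarith
    qed
    then show ?thesis using exp_mean_add_const[OF g, of q d] by simp
  qed
  have "exp_mean q M f \<le> exp_mean q M g + d" using f g le by (rule *)
  moreover have "exp_mean q M g \<le> exp_mean q M f + d"
    using g f le by (intro *) (auto simp: abs_minus_commute)
  ultimately show ?thesis by linarith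
qed

text \<open>Differentiation under the integral by dominated convergence; the Lipschitz bound in t
  dominates the difference quotients. The same quotient covers q = 0, where its denominator is the
  total mass.\<close>

lemma exp_mean_has_derivative:
  fixes f :: "real \<Rightarrow> 'a \<Rightarrow> real"
  assumes f: "\<And>t. f t \<in> borel_measurable M" "\<And>x. x \<in> space M \<Longrightarrow> \<bar>f 0 x\<bar> \<le> B"
    and lip: "\<And>t x. x \<in> space M \<Longrightarrow> \<bar>f t x - f 0 x\<bar> \<le> L * \<bar>t\<bar>"
    and g: "g \<in> borel_measurable M"
    and deriv: "AE x in M. ((\<lambda>t. f t x) has_real_derivative g x) (at 0)"
  shows "((\<lambda>t. exp_mean q M (f t)) has_real_derivative
           (\<integral>x. g x * exp (q * f 0 x) \<partial>M) / (\<integral>x. exp (q * f 0 x) \<partial>M)) (at 0)"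
proof -
  have bdd: "\<bar>f t x\<bar> \<le> B + L * \<bar>t\<bar>" if "x \<in> space M" for t x
    using lip[OF that, of t] f(2)[OF that] by linarith
  have L: "0 \<le> L"
  proof -
    obtain x where "x \<in> space M" using nonzero by fastforce
    from lip[OF this, of 1] show ?thesis by simp
  qed
  \<comment> \<open>Applied to the identity for q = 0 and to F y = exp (q y) otherwise. For |t| <= 1
    all values f t x lie in the interval of radius B + L, so a Lipschitz bound for F on that
    interval is enough.\<close>
  have diff: "((\<lambda>t. \<integral>x. F (f t x) \<partial>M) has_real_derivative (\<integral>x. g x * F' (f 0 x) \<partial>M)) (at 0)"
    if F': "\<And>y. (F has_real_derivative F' y) (at y)"
      and FB: "\<And>y z. \<bar>y\<bar> \<le> B + L \<Longrightarrow> \<bar>z\<bar> \<le> B + L \<Longrightarrow> \<bar>F y - F z\<bar> \<le> D * \<bar>y - z\<bar>"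
      and F'cont: "continuous_on UNIV F'" and D: "D \<ge> 0"
    for F F' :: "real \<Rightarrow> real" and D
  proof -
    have Fcont: "continuous_on UNIV F"
      using F' by (meson DERIV_isCont continuous_at_imp_continuous_on)
    have Fmeas: "F \<in> borel_measurable borel" using Fcont by (rule borel_measurable_continuous_onI)
    have F'meas: "F' \<in> borel_measurable borel" using F'cont by (rule borel_measurable_continuous_onI)
    have Fint: "integrable M (\<lambda>x. F (f t x))" for t
    proof -
      have "bounded (F ` {- (B + L * \<bar>t\<bar>) .. B + L * \<bar>t\<bar>})"
        by (intro compact_imp_bounded compact_continuous_image continuous_on_subset[OF Fcont]) auto
      then obtain K where "\<forall>y \<in> {- (B + L * \<bar>t\<bar>) .. B + L * \<bar>t\<bar>}. \<bar>F y\<bar> \<le> K"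
        unfolding bounded_iff by auto
      then have K: "\<bar>F y\<bar> \<le> K" if "\<bar>y\<bar> \<le> B + L * \<bar>t\<bar>" for y
        using that by (simp add: abs_le_iff)
      show ?thesis
      proof (rule integrable_bounded)
        show "(\<lambda>x. F (f t x)) \<in> borel_measurable M" using f(1) Fmeas by (rule measurable_compose)
        show "\<bar>F (f t x)\<bar> \<le> K" if "x \<in> space M" for x
          using bdd[OF that, of t] by (rule K)
      qed
    qed
    have "((\<lambda>t. ((\<integral>x. F (f t x) \<partial>M) - (\<integral>x. F (f 0 x) \<partial>M)) / (t - 0)) \<longlongrightarrow> (\<integral>x. g x * F' (f 0 x) \<partial>M)) (at 0)"
      unfolding tendsto_at_iff_sequentially
    proof (intro allI impI)
      fix X :: "nat \<Rightarrow> real" assume X: "\<forall>i. X i \<in> UNIV - {0}" and X0: "X \<longlonglongrightarrow> 0"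
      then have "\<forall>\<^sub>F i in sequentially. dist (X i) 0 < 1" by (intro tendstoD) auto
      then obtain N where N: "\<And>i. i \<ge> N \<Longrightarrow> \<bar>X i\<bar> < 1" by (auto simp: eventually_sequentially)
      \<comment> \<open>Dropping the first N terms keeps the parameter below 1 in absolute value,
        where D * L bounds the quotients.\<close>
      define G where "G i x = (F (f (X (i + N)) x) - F (f 0 x)) / X (i + N)" for i x
      have "(\<lambda>i. \<integral>x. G i x \<partial>M) \<longlonglongrightarrow> (\<integral>x. g x * F' (f 0 x) \<partial>M)"
      proof (rule integral_dominated_convergence[where w = "\<lambda>_. D * L"])
        show "(\<lambda>x. g x * F' (f 0 x)) \<in> borel_measurable M"
          by (intro borel_measurable_times g measurable_compose[OF f(1) F'meas])
        show "G i \<in> borel_measurable M" for i unfolding G_def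
          by (intro borel_measurable_divide borel_measurable_diff borel_measurable_const measurable_compose[OF f(1) Fmeas])
        show "integrable M (\<lambda>_. D * L)" by simp
        show "AE x in M. (\<lambda>i. G i x) \<longlonglongrightarrow> g x * F' (f 0 x)"
        proof (rule AE_mp[OF deriv], rule AE_I2, rule impI)
          fix x assume "((\<lambda>t. f t x) has_real_derivative g x) (at 0)"
          with F' have "((\<lambda>t. F (f t x)) has_real_derivative F' (f 0 x) * g x) (at 0)"
            by (rule DERIV_chain2)
          then have "((\<lambda>t. (F (f t x) - F (f 0 x)) / (t - 0)) \<longlongrightarrow> F' (f 0 x) * g x) (at 0)"
            by (simp add: has_field_derivative_iff)
          then have "(\<lambda>i. (F (f (X i) x) - F (f 0 x)) / X i) \<longlonglongrightarrow> F' (f 0 x) * g x"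
            using X X0 by (simp add: tendsto_at_iff_sequentially o_def)
          then show "(\<lambda>i. G i x) \<longlonglongrightarrow> g x * F' (f 0 x)"
            unfolding G_def mult.commute[of "g x"] by (rule LIMSEQ_ignore_initial_segment)
        qed
        show "AE x in M. norm (G i x) \<le> D * L" for i
        proof (rule AE_I2)
          fix x assume x: "x \<in> space M"
          let ?t = "X (i + N)"
          have t: "\<bar>?t\<bar> < 1" "?t \<noteq> 0" using N[of "i + N"] X by auto
          have "L * \<bar>?t\<bar> \<le> L" using t L mult_left_le[of "\<bar>?t\<bar>" L] by simp
          then have "\<bar>F (f ?t x) - F (f 0 x)\<bar> \<le> D * \<bar>f ?t x - f 0 x\<bar>"
            using bdd[OF x, of ?t] bdd[OF x, of 0] L by (intro FB) auto
          also have "\<dots> \<le> D * (L * \<bar>?t\<bar>)" using lip[OF x] D by (intro mult_left_mono) auto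
          finally show "norm (G i x) \<le> D * L"
            using t by (simp add: G_def field_simps abs_mult)
        qed
      qed
      moreover have "(\<integral>x. G i x \<partial>M) =
          ((\<integral>x. F (f (X (i + N)) x) \<partial>M) - (\<integral>x. F (f 0 x) \<partial>M)) / X (i + N)" for i
        unfolding G_def using Fint by simp
      ultimately have "(\<lambda>i. ((\<integral>x. F (f (X (i + N)) x) \<partial>M) - (\<integral>x. F (f 0 x) \<partial>M)) / X (i + N))
          \<longlonglongrightarrow> (\<integral>x. g x * F' (f 0 x) \<partial>M)" by simp
      then show "((\<lambda>t. ((\<integral>x. F (f t x) \<partial>M) - (\<integral>x. F (f 0 x) \<partial>M)) / (t - 0)) \<circ> X)
          \<longlonglongrightarrow> (\<integral>x. g x * F' (f 0 x) \<partial>M)"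
        unfolding o_def diff_zero by (rule LIMSEQ_offset)
    qed
    then show ?thesis by (simp add: has_field_derivative_iff)
  qed
  show ?thesis
  proof (cases "q = 0")
    case True
    have "((\<lambda>t. \<integral>x. f t x \<partial>M) has_real_derivative (\<integral>x. g x * 1 \<partial>M)) (at 0)"
      by (rule diff[of "\<lambda>y. y" "\<lambda>_. 1" 1]) auto
    then have "((\<lambda>t. (\<integral>x. f t x \<partial>M) / measure M (space M)) has_real_derivative
        (\<integral>x. g x * 1 \<partial>M) / measure M (space M)) (at 0)"
      by (rule DERIV_cdivide)
    then show ?thesis using True by (simp add: exp_mean_def)
  next
    case False
    \<comment> \<open>A bound for the derivative q exp (q y) when |y| <= B + L.\<close>
    define D where "D = \<bar>q\<bar> * exp (\<bar>q\<bar> * (B + L))"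
    have *: "((\<lambda>t. \<integral>x. exp (q * f t x) \<partial>M) has_real_derivative (\<integral>x. g x * (q * exp (q * f 0 x)) \<partial>M)) (at 0)"
    proof (rule diff[of "\<lambda>y. exp (q * y)" _ D])
      show "((\<lambda>y. exp (q * y)) has_real_derivative q * exp (q * y)) (at y)" for y
        by (auto intro!: derivative_eq_intros)
      show "\<bar>exp (q * y) - exp (q * z)\<bar> \<le> D * \<bar>y - z\<bar>"
        if "\<bar>y\<bar> \<le> B + L" "\<bar>z\<bar> \<le> B + L" for y z
      proof -
        have "norm (exp (q * y) - exp (q * z)) \<le> D * norm (y - z)"
        proof (rule field_differentiable_bound[of "{- (B + L) .. B + L}"])
          show "((\<lambda>y. exp (q * y)) has_field_derivative q * exp (q * x)) (at x within {- (B + L)..B + L})" for x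
            by (auto intro!: derivative_eq_intros)
          show "norm (q * exp (q * x)) \<le> D" if "x \<in> {- (B + L)..B + L}" for x
            using that abs_exp_mult_le[of x "B + L" q] by (auto simp: D_def abs_mult intro!: mult_left_mono)
        qed (use that in auto)
        then show ?thesis by simp
      qed
      show "D \<ge> 0" by (simp add: D_def)
    qed (auto intro!: continuous_intros)
    have pos: "(\<integral>x. exp (q * f 0 x) \<partial>M) > 0" by (rule integral_exp_pos[OF f(1) f(2)])
    have "((\<lambda>t. ln (\<integral>x. exp (q * f t x) \<partial>M) / q) has_real_derivative
        ((1 / (\<integral>x. exp (q * f 0 x) \<partial>M)) * (\<integral>x. g x * (q * exp (q * f 0 x)) \<partial>M)) / q) (at 0)"
      by (intro DERIV_cdivide DERIV_chain2[OF DERIV_ln_divide[OF pos] *])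
    moreover have "(\<integral>x. g x * (q * exp (q * f 0 x)) \<partial>M) = q * (\<integral>x. g x * exp (q * f 0 x) \<partial>M)"
      by (simp flip: integral_mult_right_zero add: ac_simps)
    ultimately show ?thesis using False by (simp add: exp_mean_def)
  qed
qed

end

section \<open>Measures determined by continuous functions\<close>

text \<open>Indicators of closed sets are limits of continuous functions with values in [0, 1], and
  the closed sets form an intersection-stable generator of the Borel sets.\<close>

lemma finite_measure_eqI_continuous:
  fixes U :: "'a::metric_space set"
  assumes fin: "finite_measure M" "finite_measure N"
    and sets: "sets M = sets (restrict_space borel U)" "sets N = sets (restrict_space borel U)"
    and eq: "\<And>g::'a \<Rightarrow> real. continuous_on U g \<Longrightarrow> (\<integral>u. g u \<partial>M) = (\<integral>u. g u \<partial>N)"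
  shows "M = N"
proof -
  have id: "(\<lambda>x. x) \<in> measurable P borel" if "sets P = sets (restrict_space borel U)" for P :: "'a measure"
    unfolding measurable_cong_sets[OF that refl] by (intro measurable_restrict_space1) auto
  have space: "space P = U" if "sets P = sets (restrict_space borel U)" for P :: "'a measure"
    using sets_eq_imp_space_eq[OF that] by (simp add: space_restrict_space)
  have lim: "(\<lambda>k::nat. \<integral>u. max 0 (1 - real k * infdist u F) \<partial>P) \<longlonglongrightarrow> measure P (F \<inter> U)"
    if P: "finite_measure P" "sets P = sets (restrict_space borel U)" and F: "closed F" "F \<noteq> {}" for P F
  proof -
    interpret P: finite_measure P by fact
    have meas: "(\<lambda>u. max 0 (1 - real k * infdist u F)) \<in> borel_measurable P" for k
      unfolding measurable_cong_sets[OF P(2) refl]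
      by (intro borel_measurable_continuous_on_restrict continuous_intros)
    have FU: "F \<inter> U \<in> sets P"
      unfolding P(2) sets_restrict_space using F(1) by (intro image_eqI[of _ _ F]) auto
    have "(\<lambda>k::nat. \<integral>u. max 0 (1 - real k * infdist u F) \<partial>P) \<longlonglongrightarrow> (\<integral>u. indicator (F \<inter> U) u \<partial>P)"
    proof (rule integral_dominated_convergence[where w = "\<lambda>_. 1"])
      show "AE u in P. (\<lambda>k::nat. max 0 (1 - real k * infdist u F)) \<longlonglongrightarrow> indicator (F \<inter> U) u"
      proof (rule AE_I2)
        fix u assume "u \<in> space P"
        then have u: "u \<in> U" by (simp add: space[OF P(2)])
        show "(\<lambda>k::nat. max 0 (1 - real k * infdist u F)) \<longlonglongrightarrow> indicator (F \<inter> U) u"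
        proof (cases "u \<in> F")
          case True
          then show ?thesis using u by simp
        next
          case False
          then have pos: "infdist u F > 0"
            using in_closed_iff_infdist_zero[OF F] infdist_nonneg[of u F] by (auto simp: less_le)
          obtain n :: nat where n: "1 < real n * infdist u F" using reals_Archimedean3[OF pos] by blast
          have "\<forall>\<^sub>F k::nat in sequentially. indicator (F \<inter> U) u = max 0 (1 - real k * infdist u F)"
            unfolding eventually_sequentially
          proof (intro exI[of _ n] allI impI)
            fix k assume "n \<le> k"
            then have "real n * infdist u F \<le> real k * infdist u F" using pos by (intro mult_right_mono) auto
            then show "indicator (F \<inter> U) u = max 0 (1 - real k * infdist u F)" using n False by simp
          qed
          then show ?thesis by (rule Lim_transform_eventually[OF tendsto_const])
        qed
      qed
      show "AE u in P. norm (max 0 (1 - real k * infdist u F)) \<le> 1" for k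
        by (intro AE_I2) (auto simp: infdist_nonneg)
      show "indicator (F \<inter> U) \<in> borel_measurable P" using FU by simp
    qed (use meas in simp_all)
    then show ?thesis using FU by simp
  qed
  have closed_eq: "emeasure M (F \<inter> U) = emeasure N (F \<inter> U)" if F: "closed F" for F
  \<comment> \<open>\<open>infdist\<close> to the empty set is 0 by convention, which would make the
    approximating functions constantly 1; hence the separate case.\<close>
  proof (cases "F = {}")
    case False
    have "(\<integral>u. max 0 (1 - real k * infdist u F) \<partial>M) = (\<integral>u. max 0 (1 - real k * infdist u F) \<partial>N)" for k :: nat
      by (intro eq continuous_intros)
    then have "measure M (F \<inter> U) = measure N (F \<inter> U)"
      using lim[OF fin(1) sets(1) F False] lim[OF fin(2) sets(2) F False]
      by (simp add: LIMSEQ_unique)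
    then show ?thesis using fin by (simp add: finite_measure.emeasure_eq_measure)
  qed simp
  have distr_eq: "emeasure (distr P borel (\<lambda>x. x)) A = emeasure P (A \<inter> U)"
    if "sets P = sets (restrict_space borel U)" "A \<in> sets borel" for P A
    using that id[OF that(1)] space[OF that(1)] by (simp add: emeasure_distr)
  \<comment> \<open>Both measures are carried to the whole space, where the closed sets generate the
    sigma-algebra, and are read off on U afterwards.\<close>
  have "distr M borel (\<lambda>x. x) = distr N borel (\<lambda>x. x)"
  proof (rule measure_eqI_generator_eq[of "Collect closed" UNIV _ _ "\<lambda>_. UNIV"])
    show "emeasure (distr M borel (\<lambda>x. x)) F = emeasure (distr N borel (\<lambda>x. x)) F"
      if "F \<in> Collect closed" for F
      using that closed_eq by (simp add: distr_eq sets)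
    show "emeasure (distr M borel (\<lambda>x. x)) UNIV \<noteq> \<infinity>"
      using fin(1) by (simp add: distr_eq sets finite_measure.emeasure_eq_measure)
  qed (auto simp: Int_stable_def borel_eq_closed)
  show ?thesis
  proof (rule measure_eqI)
    fix A assume "A \<in> sets M"
    then obtain B where B: "B \<in> sets borel" "A = B \<inter> U" by (auto simp: sets(1) sets_restrict_space)
    then show "emeasure M A = emeasure N A"
      using distr_eq[OF sets(1) B(1)] distr_eq[OF sets(2) B(1)] \<open>distr M borel _ = _\<close> by simp
  qed (simp add: sets)
qed

section \<open>A dual pair of variational problems\<close>

lemma compact_continuous_bounded:
  fixes f :: "'a::topological_space \<Rightarrow> real"
  assumes "compact S" "continuous_on S f"
  obtains B where "\<And>x. x \<in> S \<Longrightarrow> \<bar>f x\<bar> \<le> B"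
proof -
  have "bounded (f ` S)" using assms by (intro compact_imp_bounded compact_continuous_image)
  then show ?thesis using that unfolding bounded_iff by auto
qed

text \<open>Outside a ball around x the remaining compact set has a maximum strictly below F x, so
  the sequence must eventually stay inside the ball.\<close>

lemma maximizing_sequence_converges:
  fixes F :: "'a::heine_borel \<Rightarrow> real"
  assumes S: "compact S" and F: "continuous_on S F" and x: "x \<in> S"
    and uniq: "\<And>y. y \<in> S \<Longrightarrow> y \<noteq> x \<Longrightarrow> F y < F x"
    and X: "\<And>n::nat. X n \<in> S" and lim: "(\<lambda>n. F (X n)) \<longlonglongrightarrow> F x"
  shows "X \<longlonglongrightarrow> x"
proof (rule tendstoI)
  fix e :: real assume e: "e > 0"
  show "\<forall>\<^sub>F n in sequentially. dist (X n) x < e"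
  proof (cases "S - ball x e = {}")
    case True
    then have "dist (X n) x < e" for n using X[of n] by (auto simp: dist_commute)
    then show ?thesis by simp
  next
    case False
    have "compact (S - ball x e)" using S by (simp add: compact_diff)
    then obtain y where y: "y \<in> S - ball x e" "\<And>z. z \<in> S - ball x e \<Longrightarrow> F z \<le> F y"
      using continuous_attains_sup[OF _ False continuous_on_subset[OF F]] by blast
    have "F y < F x" using y e by (intro uniq) auto
    then have "\<forall>\<^sub>F n in sequentially. F y < F (X n)" using lim by (rule order_tendstoD(1)[rotated])
    then show ?thesis
    proof (rule eventually_mono)
      fix n assume "F y < F (X n)"
      then have "X n \<in> ball x e" using y(2)[of "X n"] X[of n] by force
      then show "dist (X n) x < e" by (simp add: dist_commute)
    qed
  qed
qed

text \<open>Later U is the compact set of normals, V the set of unit vectors of the cone, and c the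
  logarithm of -(u . v). The assumptions are symmetric in U and V, so the swapped problem is again
  an instance and yields biconjugates.\<close>

locale dual_problem =
  fixes U :: "'a::euclidean_space set" and V :: "'b::euclidean_space set" and c :: "'a \<Rightarrow> 'b \<Rightarrow> real"
  assumes compact_U: "compact U" and compact_V: "compact V"
    and U_nonempty: "U \<noteq> {}" and V_nonempty: "V \<noteq> {}"
    and cont_c: "continuous_on (U \<times> V) (\<lambda>(u, v). c u v)"
begin

lemma continuous_c:
  assumes "v \<in> V" shows "continuous_on U (\<lambda>u. c u v)"
proof -
  have "continuous_on U (\<lambda>u. (\<lambda>(u, v). c u v) (u, v))"
    using assms by (intro continuous_on_compose2[OF cont_c] continuous_intros) auto
  then show ?thesis by simp
qed

text \<open>The c-transform of optimal transport; for the cost used later its exponential is the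
  radial function of a Wulff shape.\<close>

definition ctrans :: "('a \<Rightarrow> real) \<Rightarrow> 'b \<Rightarrow> real" where
  "ctrans \<phi> v = (SUP u\<in>U. \<phi> u - c u v)"

lemma ctrans_max:
  assumes "continuous_on U \<phi>" "v \<in> V"
  obtains u where "u \<in> U" "ctrans \<phi> v = \<phi> u - c u v" "\<And>u'. u' \<in> U \<Longrightarrow> \<phi> u' - c u' v \<le> ctrans \<phi> v"
proof -
  have "continuous_on U (\<lambda>u. \<phi> u - c u v)"
    using assms by (intro continuous_intros continuous_c)
  from continuous_attains_sup[OF compact_U U_nonempty this]
  obtain u where u: "u \<in> U" "\<And>u'. u' \<in> U \<Longrightarrow> \<phi> u' - c u' v \<le> \<phi> u - c u v" by blast
  then have "ctrans \<phi> v = \<phi> u - c u v"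
    unfolding ctrans_def by (intro cSup_eq_maximum) auto
  with u show ?thesis using that by metis
qed

lemma ctrans_ge:
  assumes "continuous_on U \<phi>" "u \<in> U" "v \<in> V"
  shows "\<phi> u - c u v \<le> ctrans \<phi> v"
  using ctrans_max[OF assms(1,3)] assms(2) by metis

lemma ctrans_le:
  assumes "continuous_on U \<phi>" "v \<in> V" "\<And>u. u \<in> U \<Longrightarrow> \<phi> u - c u v \<le> b"
  shows "ctrans \<phi> v \<le> b"
  using ctrans_max[OF assms(1,2)] assms(3) by metis

lemma ctrans_add_const:
  assumes "continuous_on U \<phi>" "v \<in> V"
  shows "ctrans (\<lambda>u. \<phi> u + k) v = ctrans \<phi> v + k"
proof -
  have *: "continuous_on U (\<lambda>u. \<phi> u + k)" using assms by (intro continuous_intros)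
  obtain u where u: "u \<in> U" "ctrans \<phi> v = \<phi> u - c u v" using ctrans_max[OF assms] by metis
  show ?thesis
  proof (rule antisym)
    show "ctrans (\<lambda>u. \<phi> u + k) v \<le> ctrans \<phi> v + k"
      using ctrans_ge[OF assms(1) _ assms(2)] by (intro ctrans_le[OF * assms(2)]) force
    show "ctrans \<phi> v + k \<le> ctrans (\<lambda>u. \<phi> u + k) v"
      using ctrans_ge[OF * u(1) assms(2)] u(2) by simp
  qed
qed

lemma ctrans_dist_le:
  assumes "continuous_on U \<phi>" "continuous_on U \<psi>" "v \<in> V" "\<And>u. u \<in> U \<Longrightarrow> \<bar>\<phi> u - \<psi> u\<bar> \<le> d"
  shows "\<bar>ctrans \<phi> v - ctrans \<psi> v\<bar> \<le> d"
proof -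
  obtain u where "u \<in> U" "ctrans \<phi> v = \<phi> u - c u v" using ctrans_max assms by metis
  moreover obtain u' where "u' \<in> U" "ctrans \<psi> v = \<psi> u' - c u' v" using ctrans_max assms by metis
  ultimately show ?thesis
    using ctrans_ge[of \<psi> u v] ctrans_ge[of \<phi> u' v] assms(4)[of u] assms(4)[of u'] assms by linarith
qed

text \<open>A maximiser for v competes for v' and conversely. The modulus of continuity therefore
  comes from c alone, whatever \<phi> is, which is the source of compactness.\<close>

lemma ctrans_modulus:
  assumes "continuous_on U \<phi>" "v \<in> V" "v' \<in> V" "\<And>u. u \<in> U \<Longrightarrow> \<bar>c u v - c u v'\<bar> \<le> d"
  shows "\<bar>ctrans \<phi> v - ctrans \<phi> v'\<bar> \<le> d"
proof -
  obtain u where "u \<in> U" "ctrans \<phi> v = \<phi> u - c u v" using ctrans_max assms by metis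
  moreover obtain u' where "u' \<in> U" "ctrans \<phi> v' = \<phi> u' - c u' v'" using ctrans_max assms by metis
  ultimately show ?thesis
    using ctrans_ge[of \<phi> u v'] ctrans_ge[of \<phi> u' v] assms(4)[of u] assms(4)[of u'] assms by linarith
qed

lemma c_equicontinuous:
  assumes "e > 0"
  obtains d where "d > 0"
    "\<And>u u' v v'. u \<in> U \<Longrightarrow> u' \<in> U \<Longrightarrow> v \<in> V \<Longrightarrow> v' \<in> V \<Longrightarrow> dist u u' < d \<Longrightarrow> dist v v' < d
       \<Longrightarrow> \<bar>c u v - c u' v'\<bar> < e"
proof -
  have "uniformly_continuous_on (U \<times> V) (\<lambda>(u, v). c u v)"
    by (intro compact_uniformly_continuous cont_c compact_Times compact_U compact_V)
  with assms obtain d where d: "d > 0"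
    "\<And>x x'. x \<in> U \<times> V \<Longrightarrow> x' \<in> U \<times> V \<Longrightarrow> dist x' x < d \<Longrightarrow>
        dist ((\<lambda>(u, v). c u v) x') ((\<lambda>(u, v). c u v) x) < e"
    unfolding uniformly_continuous_on_def by metis
  show ?thesis
  proof (rule that[of "d / 2"])
    fix u u' v v' assume *: "u \<in> U" "u' \<in> U" "v \<in> V" "v' \<in> V" "dist u u' < d / 2" "dist v v' < d / 2"
    have "dist (u, v) (u', v') \<le> dist u u' + dist v v'"
      by (simp add: dist_Pair_Pair sqrt_sum_squares_le_sum)
    then have "dist (u, v) (u', v') < d" using * by linarith
    then show "\<bar>c u v - c u' v'\<bar> < e"
      using d(2)[of "(u', v')" "(u, v)"] * by (simp add: dist_real_def)
  qed (use d in simp)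
qed

lemma continuous_ctrans:
  assumes "continuous_on U \<phi>"
  shows "continuous_on V (ctrans \<phi>)"
  unfolding continuous_on_iff
proof (intro ballI allI impI)
  fix v and e :: real assume v: "v \<in> V" and "e > 0"
  then have "e / 2 > 0" by simp
  from c_equicontinuous[OF this] obtain d where d: "d > 0"
    "\<And>u u' v v'. u \<in> U \<Longrightarrow> u' \<in> U \<Longrightarrow> v \<in> V \<Longrightarrow> v' \<in> V \<Longrightarrow> dist u u' < d \<Longrightarrow> dist v v' < d
       \<Longrightarrow> \<bar>c u v - c u' v'\<bar> < e / 2" by metis
  have "dist (ctrans \<phi> v') (ctrans \<phi> v) < e" if "v' \<in> V" "dist v' v < d" for v'
  proof -
    have "\<bar>ctrans \<phi> v' - ctrans \<phi> v\<bar> \<le> e / 2"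
      using d(1) d(2)[of _ _ v' v] that v by (intro ctrans_modulus assms) (auto intro!: less_imp_le)
    then show ?thesis using \<open>e > 0\<close> by (simp add: dist_real_def)
  qed
  then show "\<exists>d>0. \<forall>x'\<in>V. dist x' v < d \<longrightarrow> dist (ctrans \<phi> x') (ctrans \<phi> v) < e"
    using d(1) by blast
qed

text \<open>A uniformly equicontinuous class, closed under adding constants, that contains all
  biconjugates.\<close>

definition c_regular :: "('a \<Rightarrow> real) \<Rightarrow> bool" where
  "c_regular \<phi> \<longleftrightarrow>
     (\<forall>u\<in>U. \<forall>u'\<in>U. \<forall>e. (\<forall>v\<in>V. \<bar>c u v - c u' v\<bar> \<le> e) \<longrightarrow> \<bar>\<phi> u - \<phi> u'\<bar> \<le> e)"

lemma c_regular_equicontinuous: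
  assumes "e > 0"
  obtains d where "d > 0"
    "\<And>\<phi> u u'. c_regular \<phi> \<Longrightarrow> u \<in> U \<Longrightarrow> u' \<in> U \<Longrightarrow> dist u u' < d \<Longrightarrow> \<bar>\<phi> u - \<phi> u'\<bar> < e"
proof -
  have "e / 2 > 0" using assms by simp
  from c_equicontinuous[OF this] obtain d where d: "d > 0"
    "\<And>u u' v v'. u \<in> U \<Longrightarrow> u' \<in> U \<Longrightarrow> v \<in> V \<Longrightarrow> v' \<in> V \<Longrightarrow> dist u u' < d \<Longrightarrow> dist v v' < d
       \<Longrightarrow> \<bar>c u v - c u' v'\<bar> < e / 2" by metis
  show ?thesis
  proof (rule that[OF d(1)])
    fix \<phi> u u' assume *: "c_regular \<phi>" "u \<in> U" "u' \<in> U" "dist u u' < d"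
    have "\<bar>c u v - c u' v\<bar> \<le> e / 2" if "v \<in> V" for v
      using d(2)[of u u' v v] * that d(1) by simp
    then have "\<bar>\<phi> u - \<phi> u'\<bar> \<le> e / 2" using * unfolding c_regular_def by blast
    then show "\<bar>\<phi> u - \<phi> u'\<bar> < e" using assms by simp
  qed
qed

lemma continuous_c_regular:
  assumes "c_regular \<phi>" shows "continuous_on U \<phi>"
  unfolding continuous_on_iff
proof (intro ballI allI impI)
  fix u and e :: real assume "u \<in> U" "e > 0"
  then show "\<exists>d>0. \<forall>x'\<in>U. dist x' u < d \<longrightarrow> dist (\<phi> x') (\<phi> u) < e"
    using c_regular_equicontinuous[of e] assms unfolding dist_real_def by metis
qed

text \<open>\<phi>' u is the minimum over v of \<open>ctrans \<phi> v + c u v\<close>. From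
  \<open>ctrans \<phi> v >= \<phi> u - c u v\<close> follows \<phi> <= \<phi>', and the definition
  gives \<open>\<phi>' u - c u v <= ctrans \<phi> v\<close>. Up to sign \<phi>' is a transform over
  V, so it inherits the modulus of c.\<close>

lemma c_biconjugate:
  assumes \<phi>: "continuous_on U \<phi>"
  obtains \<phi>' where "c_regular \<phi>'" "\<And>u. u \<in> U \<Longrightarrow> \<phi> u \<le> \<phi>' u" "\<And>v. v \<in> V \<Longrightarrow> ctrans \<phi>' v \<le> ctrans \<phi> v"
proof -
  have "continuous_on (V \<times> U) (\<lambda>x. (\<lambda>(u, v). c u v) (snd x, fst x))"
    by (intro continuous_on_compose2[OF cont_c]) (auto intro!: continuous_intros)
  then interpret dual: dual_problem V U "\<lambda>v u. c u v"
    by unfold_locales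
      (auto simp: compact_U compact_V U_nonempty V_nonempty case_prod_unfold)
  define \<psi> where "\<psi> v = - ctrans \<phi> v" for v
  have \<psi>: "continuous_on V \<psi>"
    unfolding \<psi>_def by (intro continuous_intros continuous_ctrans \<phi>)
  define \<phi>' where "\<phi>' u = - dual.ctrans \<psi> u" for u
  have reg: "c_regular \<phi>'"
    unfolding c_regular_def
  proof (intro ballI allI impI)
    fix u u' e assume *: "u \<in> U" "u' \<in> U" "\<forall>v\<in>V. \<bar>c u v - c u' v\<bar> \<le> e"
    then have "\<bar>dual.ctrans \<psi> u - dual.ctrans \<psi> u'\<bar> \<le> e"
      using dual.ctrans_modulus[OF \<psi>] by blast
    then show "\<bar>\<phi>' u - \<phi>' u'\<bar> \<le> e" by (simp add: \<phi>'_def)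
  qed
  show ?thesis
  proof (rule that[OF reg])
    show "\<phi> u \<le> \<phi>' u" if "u \<in> U" for u
    proof -
      have "dual.ctrans \<psi> u \<le> - \<phi> u"
        using ctrans_ge[OF \<phi> that] by (intro dual.ctrans_le \<psi> that) (force simp: \<psi>_def)
      then show ?thesis by (simp add: \<phi>'_def)
    qed
    show "ctrans \<phi>' v \<le> ctrans \<phi> v" if "v \<in> V" for v
      using dual.ctrans_ge[OF \<psi> that]
      by (intro ctrans_le continuous_c_regular reg that) (force simp: \<phi>'_def \<psi>_def)
  qed
qed

end

section \<open>The functional and the existence of a maximiser\<close>

locale dual_problem_measures = dual_problem U V c + mu: nonzero_finite_measure \<mu> + sigma: nonzero_finite_measure \<sigma>
  for U :: "'a::euclidean_space set" and V :: "'b::euclidean_space set" and c \<mu> \<sigma> +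
  assumes sets_mu: "sets \<mu> = sets (restrict_space borel U)"
    and sets_sigma: "sets \<sigma> = sets (restrict_space borel V)"
begin

lemma space_mu: "space \<mu> = U"
  using sets_eq_imp_space_eq[OF sets_mu] by (simp add: space_restrict_space)

lemma space_sigma: "space \<sigma> = V"
  using sets_eq_imp_space_eq[OF sets_sigma] by (simp add: space_restrict_space)

lemma measurable_mu: "continuous_on U f \<Longrightarrow> f \<in> borel_measurable \<mu>"
  for f :: "'a \<Rightarrow> 'c::topological_space"
  using borel_measurable_continuous_on_restrict[of U f] measurable_cong_sets[OF sets_mu refl] by blast

lemma measurable_sigma: "continuous_on V f \<Longrightarrow> f \<in> borel_measurable \<sigma>"
  for f :: "'b \<Rightarrow> 'c::topological_space"
  using borel_measurable_continuous_on_restrict[of V f] measurable_cong_sets[OF sets_sigma refl] by blast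

text \<open>Adding a constant to \<phi> adds the same constant to both means, so the difference sees
  \<phi> only up to constants.\<close>

definition objective :: "real \<Rightarrow> real \<Rightarrow> ('a \<Rightarrow> real) \<Rightarrow> real" where
  "objective p q \<phi> = exp_mean p \<mu> \<phi> - exp_mean q \<sigma> (ctrans \<phi>)"

lemma objective_add_const:
  assumes \<phi>: "continuous_on U \<phi>"
  shows "objective p q (\<lambda>u. \<phi> u + k) = objective p q \<phi>"
proof -
  obtain B where B: "\<And>u. u \<in> U \<Longrightarrow> \<bar>\<phi> u\<bar> \<le> B"
    using compact_continuous_bounded[OF compact_U \<phi>] by metis
  have c: "continuous_on V (ctrans \<phi>)" by (rule continuous_ctrans[OF \<phi>])
  obtain B' where B': "\<And>v. v \<in> V \<Longrightarrow> \<bar>ctrans \<phi> v\<bar> \<le> B'"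
    using compact_continuous_bounded[OF compact_V c] by metis
  have "exp_mean q \<sigma> (ctrans (\<lambda>u. \<phi> u + k)) = exp_mean q \<sigma> (\<lambda>v. ctrans \<phi> v + k)"
    using ctrans_add_const[OF \<phi>] by (intro exp_mean_cong) (simp add: space_sigma)
  then show ?thesis
    unfolding objective_def
    using mu.exp_mean_add_const[OF measurable_mu[OF \<phi>], of B p k] B
      sigma.exp_mean_add_const[OF measurable_sigma[OF c], of B' q k] B'
    by (simp add: space_mu space_sigma)
qed

lemma objective_mono:
  assumes \<phi>: "continuous_on U \<phi>" and \<phi>': "continuous_on U \<phi>'"
    and le: "\<And>u. u \<in> U \<Longrightarrow> \<phi> u \<le> \<phi>' u" "\<And>v. v \<in> V \<Longrightarrow> ctrans \<phi>' v \<le> ctrans \<phi> v"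
  shows "objective p q \<phi> \<le> objective p q \<phi>'"
proof -
  note c = continuous_ctrans[OF \<phi>] and c' = continuous_ctrans[OF \<phi>']
  obtain B1 where "\<And>u. u \<in> U \<Longrightarrow> \<bar>\<phi> u\<bar> \<le> B1"
    using compact_continuous_bounded[OF compact_U \<phi>] by metis
  moreover obtain B2 where "\<And>u. u \<in> U \<Longrightarrow> \<bar>\<phi>' u\<bar> \<le> B2"
    using compact_continuous_bounded[OF compact_U \<phi>'] by metis
  ultimately have "exp_mean p \<mu> \<phi> \<le> exp_mean p \<mu> \<phi>'"
    using le by (intro mu.exp_mean_mono[of _ B1 _ B2] measurable_mu \<phi> \<phi>') (auto simp: space_mu)
  moreover obtain B3 where "\<And>v. v \<in> V \<Longrightarrow> \<bar>ctrans \<phi> v\<bar> \<le> B3"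
    using compact_continuous_bounded[OF compact_V c] by metis
  moreover obtain B4 where "\<And>v. v \<in> V \<Longrightarrow> \<bar>ctrans \<phi>' v\<bar> \<le> B4"
    using compact_continuous_bounded[OF compact_V c'] by metis
  ultimately show ?thesis
    using sigma.exp_mean_mono[of "ctrans \<phi>'" B4 "ctrans \<phi>" B3 q] le
    unfolding objective_def by (simp add: space_sigma measurable_sigma c c')
qed

lemma objective_dist_le:
  assumes \<phi>: "continuous_on U \<phi>" and \<phi>': "continuous_on U \<phi>'"
    and le: "\<And>u. u \<in> U \<Longrightarrow> \<bar>\<phi> u - \<phi>' u\<bar> \<le> d"
  shows "\<bar>objective p q \<phi> - objective p q \<phi>'\<bar> \<le> 2 * d"
proof -
  note c = continuous_ctrans[OF \<phi>] and c' = continuous_ctrans[OF \<phi>']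
  obtain B1 where "\<And>u. u \<in> U \<Longrightarrow> \<bar>\<phi> u\<bar> \<le> B1"
    using compact_continuous_bounded[OF compact_U \<phi>] by metis
  moreover obtain B2 where "\<And>u. u \<in> U \<Longrightarrow> \<bar>\<phi>' u\<bar> \<le> B2"
    using compact_continuous_bounded[OF compact_U \<phi>'] by metis
  ultimately have 1: "\<bar>exp_mean p \<mu> \<phi> - exp_mean p \<mu> \<phi>'\<bar> \<le> d"
    using le by (intro mu.exp_mean_dist_le[of _ B1 _ B2] measurable_mu \<phi> \<phi>') (auto simp: space_mu)
  obtain B3 where "\<And>v. v \<in> V \<Longrightarrow> \<bar>ctrans \<phi> v\<bar> \<le> B3"
    using compact_continuous_bounded[OF compact_V c] by metis
  moreover obtain B4 where "\<And>v. v \<in> V \<Longrightarrow> \<bar>ctrans \<phi>' v\<bar> \<le> B4"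
    using compact_continuous_bounded[OF compact_V c'] by metis
  ultimately have "\<bar>exp_mean q \<sigma> (ctrans \<phi>) - exp_mean q \<sigma> (ctrans \<phi>')\<bar> \<le> d"
    using ctrans_dist_le[OF \<phi> \<phi>' _ le]
    by (intro sigma.exp_mean_dist_le[of _ B3 _ B4] measurable_sigma c c') (auto simp: space_sigma)
  with 1 show ?thesis unfolding objective_def by linarith
qed

text \<open>The direct method: c-regular functions vanishing at u0 are uniformly bounded and
  equicontinuous, so by Arzela-Ascoli a maximising sequence has a uniform limit, and the objective
  is continuous in the uniform distance.\<close>

lemma objective_maximizer:
  obtains \<phi> where "continuous_on U \<phi>" "\<And>\<phi>'. continuous_on U \<phi>' \<Longrightarrow> objective p q \<phi>' \<le> objective p q \<phi>"
proof -
  obtain u0 where u0: "u0 \<in> U" using U_nonempty by blast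
  obtain B where B: "\<And>u v. u \<in> U \<Longrightarrow> v \<in> V \<Longrightarrow> \<bar>c u v\<bar> \<le> B"
    using compact_continuous_bounded[OF compact_Times[OF compact_U compact_V] cont_c]
    by (metis SigmaI case_prod_conv)
  define E where "E = {\<phi>. c_regular \<phi> \<and> \<phi> u0 = 0}"
  have Econt: "continuous_on U \<phi>" if "\<phi> \<in> E" for \<phi>
    using that continuous_c_regular by (simp add: E_def)
  have Ebound: "\<bar>\<phi> u\<bar> \<le> 2 * B" if "\<phi> \<in> E" "u \<in> U" for \<phi> u
  proof -
    have "\<bar>c u v - c u0 v\<bar> \<le> 2 * B" if "v \<in> V" for v
      using B[OF \<open>u \<in> U\<close> that] B[OF u0 that] by linarith
    then have "\<bar>\<phi> u - \<phi> u0\<bar> \<le> 2 * B" using that u0 unfolding E_def c_regular_def by blast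
    then show ?thesis using that by (simp add: E_def)
  qed
  \<comment> \<open>Neither biconjugation nor the shift that makes the function vanish at u0 lowers
    the objective, so the supremum over E bounds its value at every continuous function.\<close>
  have Edom: "\<exists>\<phi>'\<in>E. objective p q \<phi> \<le> objective p q \<phi>'" if \<phi>: "continuous_on U \<phi>" for \<phi>
  proof -
    from c_biconjugate[OF \<phi>] obtain \<phi>' where \<phi>': "c_regular \<phi>'" "\<And>u. u \<in> U \<Longrightarrow> \<phi> u \<le> \<phi>' u"
      "\<And>v. v \<in> V \<Longrightarrow> ctrans \<phi>' v \<le> ctrans \<phi> v" by metis
    have "(\<lambda>u. \<phi>' u + - \<phi>' u0) \<in> E"
      using \<phi>'(1) by (auto simp: E_def c_regular_def)
    moreover have "objective p q \<phi> \<le> objective p q (\<lambda>u. \<phi>' u + - \<phi>' u0)"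
      unfolding objective_add_const[OF continuous_c_regular[OF \<phi>'(1)]]
      by (intro objective_mono \<phi> continuous_c_regular \<phi>')
    ultimately show ?thesis by blast
  qed
  have Ene: "E \<noteq> {}" using Edom[of "\<lambda>_. 0"] by auto
  have bdd: "bdd_above (objective p q ` E)"
  proof (rule bdd_aboveI2)
    fix \<phi> assume "\<phi> \<in> E"
    then have "\<bar>objective p q \<phi> - objective p q (\<lambda>_. 0)\<bar> \<le> 2 * (2 * B)"
      using Ebound[OF \<open>\<phi> \<in> E\<close>] by (intro objective_dist_le Econt continuous_on_const) auto
    then show "objective p q \<phi> \<le> objective p q (\<lambda>_. 0) + 4 * B" by linarith
  qed
  define s where "s = (SUP \<phi>\<in>E. objective p q \<phi>)"
  have s_ge: "objective p q \<phi> \<le> s" if "\<phi> \<in> E" for \<phi>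
    unfolding s_def using that bdd by (rule cSUP_upper)
  have "\<exists>\<phi>\<in>E. s - 1 / Suc n < objective p q \<phi>" for n
    using less_cSUP_iff[OF Ene bdd, of "s - 1 / Suc n"] by (simp add: s_def)
  then obtain \<phi> where \<phi>: "\<And>n. \<phi> n \<in> E" "\<And>n. s - 1 / Suc n < objective p q (\<phi> n)" by metis
  obtain g k where g: "continuous_on U g" "strict_mono (k :: nat \<Rightarrow> nat)"
    and conv: "\<And>e. 0 < e \<Longrightarrow> \<exists>N. \<forall>n x. n \<ge> N \<and> x \<in> U \<longrightarrow> norm (\<phi> (k n) x - g x) < e"
  proof (rule Arzela_Ascoli[OF compact_U, of \<phi> "2 * B"])
    show "norm (\<phi> n u) \<le> 2 * B" if "u \<in> U" for n u using Ebound \<phi>(1) that by simp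
    show "\<exists>d>0. \<forall>n y. y \<in> U \<and> norm (x - y) < d \<longrightarrow> norm (\<phi> n x - \<phi> n y) < e"
      if x: "x \<in> U" and e: "e > 0" for x e
    proof -
      obtain d where "d > 0" and
        d: "\<And>\<phi> u u'. c_regular \<phi> \<Longrightarrow> u \<in> U \<Longrightarrow> u' \<in> U \<Longrightarrow> dist u u' < d \<Longrightarrow> \<bar>\<phi> u - \<phi> u'\<bar> < e"
        using c_regular_equicontinuous[OF e] by metis
      moreover have "c_regular (\<phi> n)" for n using \<phi>(1) by (simp add: E_def)
      ultimately show ?thesis using x by (auto simp: dist_norm)
    qed
  qed (use that in blast)
  have s_le: "s \<le> objective p q g"
  proof (rule field_le_epsilon)
    \<comment> \<open>The objective moves by at most twice the uniform distance, so closeness e / 4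
      costs e / 2; the other half of e pays for the gap 1 / Suc to the supremum.\<close>
    fix e :: real assume e: "e > 0"
    obtain N where N: "\<And>n x. n \<ge> N \<Longrightarrow> x \<in> U \<Longrightarrow> norm (\<phi> (k n) x - g x) < e / 4"
      using conv[of "e / 4"] e by auto
    obtain m where m: "1 / Suc m < e / 2" using e by (metis half_gt_zero_iff nat_approx_posE)
    define n where "n = max N m"
    have "m \<le> k n" using seq_suble[OF g(2), of n] by (simp add: n_def)
    then have "1 / Suc (k n) \<le> 1 / Suc m" by (simp add: field_simps)
    then have "s - e / 2 < objective p q (\<phi> (k n))" using \<phi>(2)[of "k n"] m by linarith
    moreover have "\<bar>objective p q (\<phi> (k n)) - objective p q g\<bar> \<le> 2 * (e / 4)"
      using N[of n] by (intro objective_dist_le Econt \<phi> g) (auto simp: n_def intro: less_imp_le)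
    ultimately show "s \<le> objective p q g + e" by linarith
  qed
  show ?thesis
  proof (rule that[OF g(1)])
    fix \<phi>' :: "'a \<Rightarrow> real" assume "continuous_on U \<phi>'"
    then obtain \<psi> where "\<psi> \<in> E" "objective p q \<phi>' \<le> objective p q \<psi>" using Edom by blast
    then show "objective p q \<phi>' \<le> objective p q g" using s_ge s_le by force
  qed
qed

end

section \<open>First variation: the derivative of the transform and the Euler-Lagrange
  equation\<close>

context dual_problem begin

definition unique_max :: "('a \<Rightarrow> real) \<Rightarrow> 'b \<Rightarrow> 'a \<Rightarrow> bool" where
  "unique_max \<phi> v u \<longleftrightarrow> u \<in> U \<and> (\<forall>u'\<in>U. u' \<noteq> u \<longrightarrow> \<phi> u' - c u' v < \<phi> u - c u v)"

lemma unique_max_ctrans: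
  assumes "continuous_on U \<phi>" "v \<in> V" "unique_max \<phi> v u"
  shows "ctrans \<phi> v = \<phi> u - c u v"
  using assms ctrans_max[OF assms(1,2)] unfolding unique_max_def by (metis not_less)

lemma unique_max_tendsto:
  assumes \<phi>: "continuous_on U \<phi>" and v: "v \<in> V" and max: "unique_max \<phi> v u"
    and X: "\<And>n::nat. X n \<in> U" and lim: "(\<lambda>n. \<phi> (X n) - c (X n) v) \<longlonglongrightarrow> ctrans \<phi> v"
  shows "X \<longlonglongrightarrow> u"
proof (rule maximizing_sequence_converges[OF compact_U])
  show "continuous_on U (\<lambda>u. \<phi> u - c u v)" by (intro continuous_intros \<phi> continuous_c v)
  show "(\<lambda>n. \<phi> (X n) - c (X n) v) \<longlonglongrightarrow> \<phi> u - c u v"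
    using lim unique_max_ctrans[OF \<phi> v max] by simp
qed (use max X in \<open>auto simp: unique_max_def\<close>)

text \<open>An envelope theorem of Danskin type: the increment of the transform lies between t g(u)
  and t g(w), where w maximises the perturbed problem, and w tends to u because the maximiser u is
  unique.\<close>

lemma ctrans_has_derivative:
  assumes \<phi>: "continuous_on U \<phi>" and g: "continuous_on U g" and v: "v \<in> V" and max: "unique_max \<phi> v u"
  shows "((\<lambda>t. ctrans (\<lambda>u. \<phi> u + t * g u) v) has_real_derivative g u) (at 0)"
proof -
  obtain B where B: "\<And>u. u \<in> U \<Longrightarrow> \<bar>g u\<bar> \<le> B"
    using compact_continuous_bounded[OF compact_U g] by metis
  have cont: "continuous_on U (\<lambda>u. \<phi> u + t * g u)" for t by (intro continuous_intros \<phi> g)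
  have u: "u \<in> U" using max by (simp add: unique_max_def)
  have \<phi>u: "ctrans \<phi> v = \<phi> u - c u v" by (rule unique_max_ctrans[OF \<phi> v max])
  have "((\<lambda>t. (ctrans (\<lambda>u. \<phi> u + t * g u) v - ctrans \<phi> v) / (t - 0)) \<longlongrightarrow> g u) (at 0)"
    unfolding tendsto_at_iff_sequentially
  proof (intro allI impI)
    fix X :: "nat \<Rightarrow> real" assume X: "\<forall>i. X i \<in> UNIV - {0}" and X0: "X \<longlonglongrightarrow> 0"
    have "\<exists>w. w \<in> U \<and> ctrans (\<lambda>u. \<phi> u + X n * g u) v = \<phi> w + X n * g w - c w v" for n
      using ctrans_max[OF cont v] by metis
    then obtain w where w: "\<And>n. w n \<in> U"
      "\<And>n. ctrans (\<lambda>u. \<phi> u + X n * g u) v = \<phi> (w n) + X n * g (w n) - c (w n) v" by metis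
    have lower: "ctrans \<phi> v + X n * g u \<le> ctrans (\<lambda>u. \<phi> u + X n * g u) v" for n
      using ctrans_ge[OF cont u v, of "X n"] \<phi>u by simp
    have upper: "ctrans (\<lambda>u. \<phi> u + X n * g u) v \<le> ctrans \<phi> v + X n * g (w n)" for n
      using ctrans_ge[OF \<phi> w(1) v, of n] w(2)[of n] by simp
    have "w \<longlonglongrightarrow> u"
    proof (rule unique_max_tendsto[OF \<phi> v max w(1)])
      have Xg: "\<bar>X n * g z\<bar> \<le> \<bar>X n\<bar> * B" if "z \<in> U" for n z
        using B[OF that] by (simp add: abs_mult mult_left_mono)
      \<comment> \<open>The perturbed maximisers almost maximise the unperturbed problem: the term X
        n * g changes the value by at most |X n| B at u and at w n, hence the factor 2.\<close>
      have "(\<lambda>n. \<phi> (w n) - c (w n) v - ctrans \<phi> v) \<longlonglongrightarrow> 0"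
      proof (rule Lim_null_comparison)
        show "(\<lambda>n. 2 * \<bar>X n\<bar> * B) \<longlonglongrightarrow> 0"
          using X0 by (auto intro!: tendsto_eq_intros)
        show "\<forall>\<^sub>F n in sequentially. norm (\<phi> (w n) - c (w n) v - ctrans \<phi> v) \<le> 2 * \<bar>X n\<bar> * B"
        proof (rule always_eventually, rule allI)
          fix n
          show "norm (\<phi> (w n) - c (w n) v - ctrans \<phi> v) \<le> 2 * \<bar>X n\<bar> * B"
            using lower[of n] upper[of n] w(2)[of n] Xg[OF u, of n] Xg[OF w(1), of n n] by auto
        qed
      qed
      then show "(\<lambda>n. \<phi> (w n) - c (w n) v) \<longlonglongrightarrow> ctrans \<phi> v" by (rule LIM_zero_cancel)
    qed
    then have gw: "(\<lambda>n. g (w n)) \<longlonglongrightarrow> g u"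
      by (rule continuous_on_tendsto_compose[OF g _ u]) (simp add: w(1))
    have "(\<lambda>n. (ctrans (\<lambda>u. \<phi> u + X n * g u) v - ctrans \<phi> v) / X n - g u) \<longlonglongrightarrow> 0"
    proof (rule Lim_null_comparison)
      show "(\<lambda>n. \<bar>g (w n) - g u\<bar>) \<longlonglongrightarrow> 0" using gw by (simp add: LIM_zero tendsto_rabs_zero)
      show "\<forall>\<^sub>F n in sequentially. norm ((ctrans (\<lambda>u. \<phi> u + X n * g u) v - ctrans \<phi> v) / X n - g u)
          \<le> \<bar>g (w n) - g u\<bar>"
      proof (rule always_eventually, rule allI)
        fix n
        let ?d = "ctrans (\<lambda>u. \<phi> u + X n * g u) v - ctrans \<phi> v"
        have Xn: "X n \<noteq> 0" using X by auto
        have d: "X n * g u \<le> ?d" "?d \<le> X n * g (w n)" using lower[of n] upper[of n] by auto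
        have "?d / X n - g u = (?d - X n * g u) / X n" using Xn by (simp add: field_simps)
        then have "norm (?d / X n - g u) = (?d - X n * g u) / \<bar>X n\<bar>" using d by (simp add: abs_divide)
        also have "\<dots> \<le> (X n * g (w n) - X n * g u) / \<bar>X n\<bar>"
          using d by (intro divide_right_mono) auto
        also have "\<dots> \<le> \<bar>X n * (g (w n) - g u)\<bar> / \<bar>X n\<bar>"
          by (intro divide_right_mono) (auto simp: right_diff_distrib)
        also have "\<dots> = \<bar>g (w n) - g u\<bar>" using Xn by (simp add: abs_mult)
        finally show "norm (?d / X n - g u) \<le> \<bar>g (w n) - g u\<bar>" .
      qed
    qed
    then show "((\<lambda>t. (ctrans (\<lambda>u. \<phi> u + t * g u) v - ctrans \<phi> v) / (t - 0)) \<circ> X) \<longlonglongrightarrow> g u"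
      unfolding o_def diff_zero by (rule LIM_zero_cancel)
  qed
  then show ?thesis by (simp add: has_field_derivative_iff)
qed

text \<open>By uniform continuity of c a maximiser for a nearby v' almost maximises for v, and
  almost maximisers converge to the unique maximiser.\<close>

lemma continuous_unique_max:
  assumes \<phi>: "continuous_on U \<phi>" and W: "W \<subseteq> V" and T: "\<And>v. v \<in> W \<Longrightarrow> unique_max \<phi> v (T v)"
  shows "continuous_on W T"
  unfolding continuous_on_sequentially
proof (intro allI ballI impI, elim conjE)
  fix X :: "nat \<Rightarrow> 'b" and v assume v: "v \<in> W" and X: "\<forall>n. X n \<in> W" and Xv: "X \<longlonglongrightarrow> v"
  have XV: "X n \<in> V" and vV: "v \<in> V" for n using X v W by auto
  have TU: "T (X n) \<in> U" for n using T X by (auto simp: unique_max_def)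
  have "(T \<circ> X) \<longlonglongrightarrow> T v"
  proof (rule unique_max_tendsto[OF \<phi> vV T[OF v]])
    show "(T \<circ> X) n \<in> U" for n using TU by simp
    have "(\<lambda>n. ctrans \<phi> (X n)) \<longlonglongrightarrow> ctrans \<phi> v"
      using continuous_on_tendsto_compose[OF continuous_ctrans[OF \<phi>] Xv vV] XV by auto
    moreover have "(\<lambda>n. c (T (X n)) (X n) - c (T (X n)) v) \<longlonglongrightarrow> 0"
    proof (rule tendstoI)
      fix e :: real assume "e > 0"
      from c_equicontinuous[OF this] obtain d where d: "d > 0"
        "\<And>u u' v v'. u \<in> U \<Longrightarrow> u' \<in> U \<Longrightarrow> v \<in> V \<Longrightarrow> v' \<in> V \<Longrightarrow> dist u u' < d \<Longrightarrow> dist v v' < d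
           \<Longrightarrow> \<bar>c u v - c u' v'\<bar> < e" by metis
      have "\<forall>\<^sub>F n in sequentially. dist (X n) v < d" using Xv d(1) by (rule tendstoD)
      then show "\<forall>\<^sub>F n in sequentially. dist (c (T (X n)) (X n) - c (T (X n)) v) 0 < e"
        by (rule eventually_mono) (use d TU XV vV in auto)
    qed
    ultimately have "(\<lambda>n. ctrans \<phi> (X n) + (c (T (X n)) (X n) - c (T (X n)) v)) \<longlonglongrightarrow> ctrans \<phi> v + 0"
      by (rule tendsto_add)
    moreover have "ctrans \<phi> (X n) = \<phi> (T (X n)) - c (T (X n)) (X n)" for n
      by (rule unique_max_ctrans[OF \<phi> XV T]) (use X in auto)
    ultimately show "(\<lambda>n. \<phi> ((T \<circ> X) n) - c ((T \<circ> X) n) v) \<longlonglongrightarrow> ctrans \<phi> v" by simp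
  qed
  then show "(T \<circ> X) \<longlonglongrightarrow> T v" .
qed

end

context dual_problem_measures begin

text \<open>The maximiser is continuous off a Borel null set; giving it the constant value u0 there
  makes it Borel measurable.\<close>

lemma measurable_unique_max:
  assumes \<phi>: "continuous_on U \<phi>" and ae: "AE v in \<sigma>. \<exists>u. unique_max \<phi> v u"
  obtains T where "T \<in> measurable \<sigma> (restrict_space borel U)" "AE v in \<sigma>. unique_max \<phi> v (T v)"
proof -
  from ae obtain N where N: "{v \<in> space \<sigma>. \<not> (\<exists>u. unique_max \<phi> v u)} \<subseteq> N" "emeasure \<sigma> N = 0" "N \<in> sets \<sigma>"
    by (rule AE_E)
  have "\<forall>v\<in>V - N. \<exists>u. unique_max \<phi> v u" using N(1) by (auto simp: space_sigma)
  then obtain S where S: "\<And>v. v \<in> V - N \<Longrightarrow> unique_max \<phi> v (S v)" by metis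
  obtain u0 where u0: "u0 \<in> U" using U_nonempty by blast
  define T where "T v = (if v \<in> V - N then S v else u0)" for v
  have TU: "T v \<in> U" for v using S u0 by (auto simp: T_def unique_max_def)
  have V: "V \<in> sets borel" using compact_V by (simp add: borel_compact)
  then have "N \<in> sets borel" using N(3) by (auto simp: sets_sigma sets_restrict_space_iff)
  moreover have "continuous_on (V - N) S" by (rule continuous_unique_max[OF \<phi> _ S]) auto
  ultimately have "T \<in> borel_measurable borel"
    unfolding T_def using V by (intro borel_measurable_continuous_on_if) auto
  then have "T \<in> measurable (restrict_space borel V) (restrict_space borel U)"
    using TU by (intro measurable_restrict_space2 measurable_restrict_space1) auto
  then have "T \<in> measurable \<sigma> (restrict_space borel U)"
    by (simp add: measurable_cong_sets[OF sets_sigma refl])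
  moreover have "AE v in \<sigma>. v \<notin> N" using N by (intro AE_not_in) auto
  then have "AE v in \<sigma>. unique_max \<phi> v (T v)"
    by (rule AE_mp) (auto intro!: AE_I2 simp: T_def S space_sigma)
  ultimately show ?thesis using that by blast
qed

text \<open>Every continuous g is an admissible direction, because \<phi> maximises over all
  continuous functions and need not stay c-regular. The derivative of t to the objective at \<phi> +
  t g exists by the envelope formula and vanishes at the maximum.\<close>

lemma objective_euler_lagrange:
  assumes \<phi>: "continuous_on U \<phi>"
    and max: "\<And>\<phi>'. continuous_on U \<phi>' \<Longrightarrow> objective p q \<phi>' \<le> objective p q \<phi>"
    and T: "T \<in> measurable \<sigma> (restrict_space borel U)" "AE v in \<sigma>. unique_max \<phi> v (T v)"
    and g: "continuous_on U g"
  shows "(\<integral>u. g u * exp (p * \<phi> u) \<partial>\<mu>) / (\<integral>u. exp (p * \<phi> u) \<partial>\<mu>) =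
    (\<integral>v. g (T v) * exp (q * ctrans \<phi> v) \<partial>\<sigma>) / (\<integral>v. exp (q * ctrans \<phi> v) \<partial>\<sigma>)" (is "?L = ?R")
proof -
  obtain B where B: "\<And>u. u \<in> U \<Longrightarrow> \<bar>g u\<bar> \<le> B"
    using compact_continuous_bounded[OF compact_U g] by metis
  obtain B1 where B1: "\<And>u. u \<in> U \<Longrightarrow> \<bar>\<phi> u\<bar> \<le> B1"
    using compact_continuous_bounded[OF compact_U \<phi>] by metis
  obtain B2 where B2: "\<And>v. v \<in> V \<Longrightarrow> \<bar>ctrans \<phi> v\<bar> \<le> B2"
    using compact_continuous_bounded[OF compact_V continuous_ctrans[OF \<phi>]] by metis
  have cont: "continuous_on U (\<lambda>u. \<phi> u + t * g u)" for t by (intro continuous_intros \<phi> g)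
  have tg: "\<bar>t * g u\<bar> \<le> B * \<bar>t\<bar>" if "u \<in> U" for t u
    using mult_right_mono[OF B[OF that], of "\<bar>t\<bar>"] by (simp add: abs_mult mult.commute)
  let ?f = "\<lambda>t v. ctrans (\<lambda>u. \<phi> u + t * g u) v"
  have "((\<lambda>t. exp_mean p \<mu> (\<lambda>u. \<phi> u + t * g u)) has_real_derivative
      (\<integral>u. g u * exp (p * (\<phi> u + 0 * g u)) \<partial>\<mu>) / (\<integral>u. exp (p * (\<phi> u + 0 * g u)) \<partial>\<mu>)) (at 0)"
    using tg B1 by (intro mu.exp_mean_has_derivative[of _ B1 B] measurable_mu cont g AE_I2)
      (auto simp: space_mu intro!: derivative_eq_intros)
  moreover have "((\<lambda>t. exp_mean q \<sigma> (?f t)) has_real_derivative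
      (\<integral>v. g (T v) * exp (q * ?f 0 v) \<partial>\<sigma>) / (\<integral>v. exp (q * ?f 0 v) \<partial>\<sigma>)) (at 0)"
  proof (rule sigma.exp_mean_has_derivative[of _ B2 B])
    show "?f t \<in> borel_measurable \<sigma>" for t by (intro measurable_sigma continuous_ctrans cont)
    show "\<bar>?f 0 v\<bar> \<le> B2" if "v \<in> space \<sigma>" for v using that B2 by (simp add: space_sigma)
    show "\<bar>?f t v - ?f 0 v\<bar> \<le> B * \<bar>t\<bar>" if "v \<in> space \<sigma>" for t v
      using that tg by (intro ctrans_dist_le cont) (auto simp: space_sigma)
    show "(\<lambda>v. g (T v)) \<in> borel_measurable \<sigma>"
      by (rule measurable_compose[OF T(1) borel_measurable_continuous_on_restrict[OF g]])
    show "AE v in \<sigma>. ((\<lambda>t. ?f t v) has_real_derivative g (T v)) (at 0)"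
      by (rule AE_mp[OF T(2)], rule AE_I2) (auto simp: space_sigma intro: ctrans_has_derivative[OF \<phi> g])
  qed
  ultimately have "((\<lambda>t. objective p q (\<lambda>u. \<phi> u + t * g u)) has_real_derivative ?L - ?R) (at 0)"
    unfolding objective_def by (intro derivative_intros) simp_all
  then have "?L - ?R = 0"
    by (rule DERIV_local_max[of _ _ _ 1]) (auto intro!: max cont)
  then show ?thesis by simp
qed

end

lemma (in finite_measure) finite_measure_density_bounded:
  fixes f :: "'a \<Rightarrow> real"
  assumes "f \<in> borel_measurable M" "\<And>x. x \<in> space M \<Longrightarrow> \<bar>f x\<bar> \<le> B" "\<And>x. 0 \<le> f x"
  shows "finite_measure (density M (\<lambda>x. ennreal (f x)))"
proof (rule finite_measureI)
  have "(\<integral>\<^sup>+ x. ennreal (f x) \<partial>M) = ennreal (\<integral>x. f x \<partial>M)"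
    using assms by (intro nn_integral_eq_integral integrable_bounded[of f B]) auto
  moreover have "emeasure (density M (\<lambda>x. ennreal (f x))) (space M) = (\<integral>\<^sup>+ x. ennreal (f x) \<partial>M)"
    using assms by (subst emeasure_density) (auto intro!: nn_integral_cong)
  ultimately show "emeasure (density M (\<lambda>x. ennreal (f x))) (space (density M (\<lambda>x. ennreal (f x)))) \<noteq> \<infinity>"
    by simp
qed

context dual_problem_measures begin

text \<open>The Euler-Lagrange equation tested with all continuous g identifies two finite measures
  up to a factor. The free constant k absorbs the normalisation of the dual curvature
  measure.\<close>

theorem pushforward_solution:
  assumes "p \<noteq> q" "k > 0"
    and unique: "\<And>\<phi>. continuous_on U \<phi> \<Longrightarrow> AE v in \<sigma>. \<exists>u. unique_max \<phi> v u"
  obtains \<phi> T where "continuous_on U \<phi>" "T \<in> measurable \<sigma> (restrict_space borel U)"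
    "AE v in \<sigma>. unique_max \<phi> v (T v)"
    "density \<mu> (\<lambda>u. ennreal (exp (p * \<phi> u))) =
     distr (density \<sigma> (\<lambda>v. ennreal (k * exp (q * ctrans \<phi> v)))) (restrict_space borel U) T"
proof -
  obtain \<phi> where \<phi>: "continuous_on U \<phi>"
    and max: "\<And>\<phi>'. continuous_on U \<phi>' \<Longrightarrow> objective p q \<phi>' \<le> objective p q \<phi>"
    using objective_maximizer by metis
  obtain T where T: "T \<in> measurable \<sigma> (restrict_space borel U)" "AE v in \<sigma>. unique_max \<phi> v (T v)"
    using measurable_unique_max[OF \<phi> unique[OF \<phi>]] by metis
  obtain B1 where B1: "\<And>u. u \<in> U \<Longrightarrow> \<bar>\<phi> u\<bar> \<le> B1"
    using compact_continuous_bounded[OF compact_U \<phi>] by metis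
  obtain B2 where B2: "\<And>v. v \<in> V \<Longrightarrow> \<bar>ctrans \<phi> v\<bar> \<le> B2"
    using compact_continuous_bounded[OF compact_V continuous_ctrans[OF \<phi>]] by metis
  define a where "a = (\<integral>u. exp (p * \<phi> u) \<partial>\<mu>)"
  define b where "b = (\<integral>v. exp (q * ctrans \<phi> v) \<partial>\<sigma>)"
  have "a > 0" unfolding a_def
    using B1 by (intro mu.integral_exp_pos measurable_mu \<phi>) (auto simp: space_mu)
  have "b > 0" unfolding b_def
    using B2 by (intro sigma.integral_exp_pos measurable_sigma continuous_ctrans \<phi>) (auto simp: space_sigma)
  text \<open>The two sides are proportional for \<open>\<phi>\<close>; since \<open>p \<noteq> q\<close>, adding a constant to \<open>\<phi>\<close> fixes the factor.\<close>
  define t where "t = ln (k * b / a) / (p - q)"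
  have t: "exp (p * t) * a / b = k * exp (q * t)"
  proof -
    have "exp (p * t) = exp ((p - q) * t) * exp (q * t)" by (simp add: algebra_simps flip: exp_add)
    also have "exp ((p - q) * t) = k * b / a"
      using assms(1,2) \<open>a > 0\<close> \<open>b > 0\<close> by (simp add: t_def)
    finally show ?thesis using \<open>a > 0\<close> \<open>b > 0\<close> by (simp add: field_simps)
  qed
  define \<psi> where "\<psi> u = \<phi> u + t" for u
  have \<psi>: "continuous_on U \<psi>" unfolding \<psi>_def by (intro continuous_intros \<phi>)
  have ctrans_\<psi>: "ctrans \<psi> v = ctrans \<phi> v + t" if "v \<in> V" for v
    unfolding \<psi>_def by (rule ctrans_add_const[OF \<phi> that])
  let ?f = "\<lambda>u. exp (p * \<psi> u)" and ?h = "\<lambda>v. k * exp (q * ctrans \<psi> v)"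
  have f: "?f \<in> borel_measurable \<mu>" by (intro measurable_mu continuous_intros \<psi>)
  have h: "?h \<in> borel_measurable \<sigma>" by (intro measurable_sigma continuous_intros continuous_ctrans \<psi>)
  have fcont: "continuous_on U ?f" by (intro continuous_intros \<psi>)
  obtain B3 where B3: "\<And>u. u \<in> U \<Longrightarrow> \<bar>?f u\<bar> \<le> B3"
    using compact_continuous_bounded[OF compact_U fcont] by metis
  have hcont: "continuous_on V ?h" by (intro continuous_intros continuous_ctrans \<psi>)
  obtain B4 where B4: "\<And>v. v \<in> V \<Longrightarrow> \<bar>?h v\<bar> \<le> B4"
    using compact_continuous_bounded[OF compact_V hcont] by metis
  have "density \<mu> (\<lambda>u. ennreal (?f u)) =
     distr (density \<sigma> (\<lambda>v. ennreal (?h v))) (restrict_space borel U) T"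
  proof (rule finite_measure_eqI_continuous)
    show "finite_measure (density \<mu> (\<lambda>u. ennreal (?f u)))"
      using f B3 by (intro mu.finite_measure_density_bounded[of _ B3]) (auto simp: space_mu)
    have "finite_measure (density \<sigma> (\<lambda>v. ennreal (?h v)))"
      using h B4 assms(2) by (intro sigma.finite_measure_density_bounded[of _ B4]) (auto simp: space_sigma)
    then show "finite_measure (distr (density \<sigma> (\<lambda>v. ennreal (?h v))) (restrict_space borel U) T)"
      using T(1) by (intro finite_measure.finite_measure_distr) auto
    show "sets (density \<mu> (\<lambda>u. ennreal (?f u))) = sets (restrict_space borel U)"
      by (simp add: sets_mu)
    fix g :: "'a \<Rightarrow> real" assume g: "continuous_on U g"
    have gU: "g \<in> borel_measurable (restrict_space borel U)"
      by (rule borel_measurable_continuous_on_restrict[OF g])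
    have "(\<integral>u. g u \<partial>density \<mu> (\<lambda>u. ennreal (?f u))) = (\<integral>u. exp (p * t) * (g u * exp (p * \<phi> u)) \<partial>\<mu>)"
      using f measurable_mu[OF g] by (subst integral_density) (auto simp: \<psi>_def exp_add ring_distribs mult_ac)
    also have "\<dots> = exp (p * t) * (\<integral>u. g u * exp (p * \<phi> u) \<partial>\<mu>)" by (rule integral_mult_right_zero)
    also have "\<dots> = exp (p * t) * a / b * (\<integral>v. g (T v) * exp (q * ctrans \<phi> v) \<partial>\<sigma>)"
      using objective_euler_lagrange[OF \<phi> max T g] \<open>a > 0\<close> \<open>b > 0\<close>
      by (simp add: a_def[symmetric] b_def[symmetric] field_simps)
    also have "\<dots> = (\<integral>v. k * exp (q * t) * (g (T v) * exp (q * ctrans \<phi> v)) \<partial>\<sigma>)"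
      unfolding t by (rule integral_mult_right_zero[symmetric])
    also have "\<dots> = (\<integral>v. ?h v *\<^sub>R g (T v) \<partial>\<sigma>)"
      by (intro Bochner_Integration.integral_cong)
        (auto simp: space_sigma ctrans_\<psi> exp_add ring_distribs mult_ac)
    also have "\<dots> = (\<integral>v. g (T v) \<partial>density \<sigma> (\<lambda>v. ennreal (?h v)))"
      using assms(2) h measurable_compose[OF T(1) gU] by (subst integral_density) auto
    also have "\<dots> = (\<integral>u. g u \<partial>distr (density \<sigma> (\<lambda>v. ennreal (?h v))) (restrict_space borel U) T)"
      using T(1) gU by (subst integral_distr) auto
    finally show "(\<integral>u. g u \<partial>density \<mu> (\<lambda>u. ennreal (?f u))) =
      (\<integral>u. g u \<partial>distr (density \<sigma> (\<lambda>v. ennreal (?h v))) (restrict_space borel U) T)" .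
  qed simp
  moreover have "AE v in \<sigma>. unique_max \<psi> v (T v)"
    using T(2) by (simp add: unique_max_def \<psi>_def)
  ultimately show ?thesis using that \<psi> T(1) by blast
qed

end

section \<open>Singular normals\<close>

text \<open>Fubini for the translates of B by t e with t in [0, 1]: integrating over x first gives
  the measure of B for every t, integrating over t first gives 0 for every x.\<close>

lemma emeasure_lborel_eq_0_if_countable_lines:
  fixes B :: "'a::euclidean_space set"
  assumes B: "B \<in> sets borel" and lines: "\<And>x. countable {t. x + t *\<^sub>R e \<in> B}"
  shows "emeasure lborel B = 0"
proof -
  note [measurable] = B
  define f where "f x t = indicator B (x + t *\<^sub>R e) * (indicator {0..1} t :: ennreal)" for x t
  have f: "case_prod f \<in> borel_measurable (lborel \<Otimes>\<^sub>M lborel)"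
    unfolding f_def case_prod_unfold by measurable
  have "(\<integral>\<^sup>+ x. indicator B (x + t *\<^sub>R e) \<partial>lborel) = emeasure lborel B" for t
  proof -
    have "emeasure lborel B = (\<integral>\<^sup>+ x. indicator B x \<partial>distr lborel borel ((+) (t *\<^sub>R e)))"
      using B by (simp add: lborel_distr_plus)
    also have "\<dots> = (\<integral>\<^sup>+ x. indicator B (t *\<^sub>R e + x) \<partial>lborel)"
      using B by (subst nn_integral_distr) auto
    finally show ?thesis by (simp add: add.commute)
  qed
  then have "(\<integral>\<^sup>+ x. f x t \<partial>lborel) = emeasure lborel B * indicator {0..1} t" for t
    unfolding f_def by (subst nn_integral_multc) simp_all
  then have "emeasure lborel B = (\<integral>\<^sup>+ t. \<integral>\<^sup>+ x. f x t \<partial>lborel \<partial>lborel)"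
    by (simp add: nn_integral_cmult)
  also have "\<dots> = (\<integral>\<^sup>+ x. \<integral>\<^sup>+ t. f x t \<partial>lborel \<partial>lborel)"
    by (rule lborel_pair.Fubini'[OF f])
  also have "\<dots> = (\<integral>\<^sup>+ x. 0 \<partial>(lborel :: 'a measure))"
  proof (rule nn_integral_cong)
    fix x
    have "{t. x + t *\<^sub>R e \<in> B} \<in> null_sets lborel"
      by (rule countable_imp_null_set_lborel[OF lines])
    then have "AE t in lborel. t \<notin> {t. x + t *\<^sub>R e \<in> B}" by (rule AE_not_in)
    then have "AE t in lborel. f x t = 0" by (auto simp: f_def)
    then show "(\<integral>\<^sup>+ t. f x t \<partial>lborel) = 0"
      by (subst nn_integral_cong_AE[of _ "\<lambda>_. 0"]) auto
  qed
  finally show ?thesis by simp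
qed

text \<open>Outer normals \<open>u\<close> at \<open>x\<close> with \<open>x \<bullet> u \<noteq> 0\<close> are rescaled to \<open>w = u / (x \<bullet> u)\<close>, so that
  \<open>w\<close> is a supergradient at \<open>x\<close> of the function homogeneous of degree 1 that equals 1 on the
  radial boundary of \<open>A\<close>.\<close>

definition scaled_normals :: "'a::euclidean_space set \<Rightarrow> 'a \<Rightarrow> 'a set" where
  "scaled_normals A x = {w. w \<bullet> x = 1 \<and> (\<forall>y\<in>A. 1 \<le> w \<bullet> y)}"

text \<open>The points where the homogeneous function has two different supergradients. Invariance
  under positive scaling later carries nullity from the space to the sphere.\<close>

definition singular_cone :: "'a::euclidean_space set \<Rightarrow> 'a set" where
  "singular_cone A = {s *\<^sub>R x | s x. s > 0 \<and> x \<in> A \<and>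
     (\<exists>w\<in>scaled_normals A x. \<exists>w'\<in>scaled_normals A x. w \<noteq> w')}"

text \<open>The bounds by k make the piece compact, hence Borel; a < b separates the two
  supergradients in the direction e, so that lines parallel to e can be used.\<close>

definition singular_part :: "'a::euclidean_space set \<Rightarrow> 'a \<Rightarrow> real \<Rightarrow> real \<Rightarrow> nat \<Rightarrow> 'a set" where
  "singular_part A e a b k = {s *\<^sub>R x | s x. 1 / real (Suc k) \<le> s \<and> s \<le> real (Suc k) \<and> x \<in> A \<and> norm x \<le> k \<and>
     (\<exists>w\<in>scaled_normals A x. \<exists>w'\<in>scaled_normals A x. norm w \<le> k \<and> norm w' \<le> k \<and>
        w \<bullet> e \<le> a \<and> b \<le> w' \<bullet> e)}"

text \<open>The continuous image of a compact set of tuples (s, x, w, w'), since all defining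
  conditions are closed.\<close>

lemma compact_singular_part:
  assumes "closed A"
  shows "compact (singular_part A e a b k)"
proof -
  define Z where "Z = {1 / real (Suc k)..real (Suc k)} \<times> (A \<inter> cball 0 k) \<times> cball (0::'a) k \<times> cball (0::'a) k"
  define X where "X z = fst (snd z)" for z :: "real \<times> 'a \<times> 'a \<times> 'a"
  define W where "W z = fst (snd (snd z))" for z :: "real \<times> 'a \<times> 'a \<times> 'a"
  define W' where "W' z = snd (snd (snd z))" for z :: "real \<times> 'a \<times> 'a \<times> 'a"
  note defs = X_def W_def W'_def
  define D where "D = {z. W z \<bullet> X z = 1} \<inter> {z. W' z \<bullet> X z = 1} \<inter> {z. W z \<bullet> e \<le> a} \<inter> {z. b \<le> W' z \<bullet> e}
     \<inter> (\<Inter>y\<in>A. {z. 1 \<le> W z \<bullet> y} \<inter> {z. 1 \<le> W' z \<bullet> y})"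
  have "closed D"
    unfolding D_def defs
    by (intro closed_Int closed_INT ballI closed_Collect_eq closed_Collect_le continuous_intros)
  moreover have "compact Z"
    unfolding Z_def using assms by (intro compact_Times closed_Int_compact) auto
  ultimately have "compact ((\<lambda>z. fst z *\<^sub>R X z) ` (Z \<inter> D))"
    unfolding X_def by (intro compact_continuous_image compact_Int_closed continuous_intros)
  also have "(\<lambda>z. fst z *\<^sub>R X z) ` (Z \<inter> D) = singular_part A e a b k"
  proof (intro equalityI subsetI)
    fix z assume "z \<in> singular_part A e a b k"
    then obtain s x w w' where "z = s *\<^sub>R x" "1 / real (Suc k) \<le> s" "s \<le> real (Suc k)" "x \<in> A" "norm x \<le> k"
       "w \<in> scaled_normals A x" "w' \<in> scaled_normals A x" "norm w \<le> k" "norm w' \<le> k"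
        "w \<bullet> e \<le> a" "b \<le> w' \<bullet> e" unfolding singular_part_def by blast
    then show "z \<in> (\<lambda>z. fst z *\<^sub>R X z) ` (Z \<inter> D)"
      by (intro image_eqI[of _ _ "(s, x, w, w')"]) (auto simp: Z_def D_def defs scaled_normals_def)
  next
    fix z assume "z \<in> (\<lambda>z. fst z *\<^sub>R X z) ` (Z \<inter> D)"
    then obtain s x w w' where "z = s *\<^sub>R x" "(s, x, w, w') \<in> Z" "(s, x, w, w') \<in> D"
      unfolding X_def by auto
    then show "z \<in> singular_part A e a b k"
      unfolding singular_part_def mem_Collect_eq
      by (intro exI[of _ s] exI[of _ x] conjI bexI[of _ w] bexI[of _ w'])
        (auto simp: Z_def D_def defs scaled_normals_def)
  qed
  finally show ?thesis .
qed

text \<open>Supergradients decrease along a line: if t0 < t1, then w at the first point and w' at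
  the second satisfy w' . e <= w . e, against w . e <= a < b <= w' . e. Exchanging the two points
  shows that a line in direction e meets the piece at most once.\<close>

lemma singular_part_line:
  assumes "a < b" and 0: "x + t0 *\<^sub>R e \<in> singular_part A e a b k"
    and 1: "x + t1 *\<^sub>R e \<in> singular_part A e a b k"
  shows "t1 \<le> t0"
proof (rule ccontr)
  assume "\<not> t1 \<le> t0"
  from 0 obtain s0 x0 w where w: "x + t0 *\<^sub>R e = s0 *\<^sub>R x0" "1 / Suc k \<le> s0" "x0 \<in> A"
    "w \<bullet> x0 = 1" "\<And>y. y \<in> A \<Longrightarrow> 1 \<le> w \<bullet> y" "w \<bullet> e \<le> a"
    unfolding singular_part_def scaled_normals_def by blast
  from 1 obtain s1 x1 w' where w': "x + t1 *\<^sub>R e = s1 *\<^sub>R x1" "1 / Suc k \<le> s1" "x1 \<in> A"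
    "w' \<bullet> x1 = 1" "\<And>y. y \<in> A \<Longrightarrow> 1 \<le> w' \<bullet> y" "b \<le> w' \<bullet> e"
    unfolding singular_part_def scaled_normals_def by blast
  have "0 < 1 / real (Suc k)" by simp
  then have s: "s0 > 0" "s1 > 0" using w(2) w'(2) by linarith+
  have *: "w \<bullet> (x + t0 *\<^sub>R e) = s0" "w' \<bullet> (x + t1 *\<^sub>R e) = s1"
    using w w' by simp_all
  have "s1 \<le> w \<bullet> (x + t1 *\<^sub>R e)" "s0 \<le> w' \<bullet> (x + t0 *\<^sub>R e)"
    using w(5)[OF w'(3)] w'(5)[OF w(3)] s by (simp_all add: w(1) w'(1))
  with * have "(t1 - t0) * (w' \<bullet> e) \<le> (t1 - t0) * (w \<bullet> e)"
    by (simp add: inner_right_distrib algebra_simps)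
  then have "w' \<bullet> e \<le> w \<bullet> e" using \<open>\<not> t1 \<le> t0\<close> by simp
  then show False using w w' \<open>a < b\<close> by linarith
qed

lemma singular_part_null:
  assumes "closed A" "a < b"
  shows "singular_part A e a b k \<in> null_sets lborel"
proof -
  have "countable {t. x + t *\<^sub>R e \<in> singular_part A e a b k}" (is "countable ?S") for x
  proof (cases "?S = {}")
    case False
    then obtain t where "t \<in> ?S" by blast
    then have "?S \<subseteq> {t}" using singular_part_line[OF assms(2), of x _ e A k] by (auto intro: antisym)
    then show ?thesis by (rule countable_subset) simp
  qed simp
  moreover have "singular_part A e a b k \<in> sets borel"
    using compact_singular_part[OF assms(1)] by (rule borel_compact)
  ultimately show ?thesis
    by (auto simp: null_sets_def intro: emeasure_lborel_eq_0_if_countable_lines)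
qed

text \<open>Two different supergradients differ in some coordinate, where rationals a < b fit
  between them; this gives a countable union of null pieces.\<close>

lemma singular_cone_null:
  assumes "closed A"
  shows "singular_cone A \<in> null_sets lborel"
proof -
  have "singular_cone A = (\<Union>e\<in>Basis. \<Union>a\<in>\<rat>. \<Union>b\<in>\<rat> \<inter> {a<..}. \<Union>k. singular_part A e a b k)"
  proof (intro equalityI subsetI)
    fix z assume "z \<in> singular_cone A"
    then obtain s x w w' where *: "z = s *\<^sub>R x" "s > 0" "x \<in> A"
      "w \<in> scaled_normals A x" "w' \<in> scaled_normals A x" "w \<noteq> w'"
      unfolding singular_cone_def by blast
    then obtain e where e: "e \<in> Basis" "w \<bullet> e \<noteq> w' \<bullet> e" using euclidean_eq_iff by blast
    have "\<exists>w\<in>scaled_normals A x. \<exists>w'\<in>scaled_normals A x. w \<bullet> e < w' \<bullet> e"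
      using * e by (meson linorder_neqE_linordered_idom)
    then obtain w w' where w: "w \<in> scaled_normals A x" "w' \<in> scaled_normals A x" "w \<bullet> e < w' \<bullet> e" by blast
    obtain a where a: "a \<in> \<rat>" "w \<bullet> e < a" "a < w' \<bullet> e" using Rats_dense_in_real[OF w(3)] by blast
    obtain b where b: "b \<in> \<rat>" "a < b" "b < w' \<bullet> e" using Rats_dense_in_real[OF a(3)] by blast
    obtain k :: nat where k: "Max {s, 1 / s, norm x, norm w, norm w'} \<le> k"
      using real_arch_simple by blast
    then have norms: "norm x \<le> k" "norm w \<le> k" "norm w' \<le> k" and "s \<le> k" "1 / s \<le> k"
      by simp_all
    then have s: "s \<le> real (Suc k)" "1 / s \<le> real (Suc k)" by simp_all
    then have "1 / real (Suc k) \<le> s" using \<open>s > 0\<close> by (simp add: field_simps)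
    moreover have "w \<bullet> e \<le> a" "b \<le> w' \<bullet> e" using a b by linarith+
    ultimately have "z \<in> singular_part A e a b k"
      unfolding singular_part_def using *(1,3) w(1,2) s(1) norms by blast
    then show "z \<in> (\<Union>e\<in>Basis. \<Union>a\<in>\<rat>. \<Union>b\<in>\<rat> \<inter> {a<..}. \<Union>k. singular_part A e a b k)"
      using e a b by blast
  next
    fix z assume "z \<in> (\<Union>e\<in>Basis. \<Union>a\<in>\<rat>. \<Union>b\<in>\<rat> \<inter> {a<..}. \<Union>k. singular_part A e a b k)"
    then obtain e and a b :: real and k where "a < b" "z \<in> singular_part A e a b k" by auto
    then obtain s x w w' where *: "z = s *\<^sub>R x" "1 / Suc k \<le> s" "x \<in> A"
       "w \<in> scaled_normals A x" "w' \<in> scaled_normals A x" "w \<bullet> e \<le> a" "b \<le> w' \<bullet> e"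
      unfolding singular_part_def by blast
    have "0 < 1 / real (Suc k)" by simp
    then have "s > 0" using *(2) by linarith
    moreover have "w \<noteq> w'" using * \<open>a < b\<close> by auto
    ultimately show "z \<in> singular_cone A" using * unfolding singular_cone_def by blast
  qed
  also have "\<dots> \<in> null_sets lborel"
  proof (intro null_sets_UN' singular_part_null assms)
    show "countable (Basis :: 'a set)" by (simp add: countable_finite)
    show "countable (\<rat> :: real set)" by (rule countable_rat)
    show "countable (\<rat> \<inter> {a<..})" for a :: real by (rule countable_subset[OF _ countable_rat]) auto
  qed auto
  finally show ?thesis .
qed

section \<open>Spherical Lebesgue measure\<close>

text \<open>Spherical measure before completion, so that the variational argument takes place on
  Borel sets.\<close>

definition sphere_measure :: "'a::euclidean_space measure" where
  "sphere_measure = scale_measure (of_nat DIM('a))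
     (distr (restrict_space lborel (cball 0 1 - {0})) (restrict_space borel (sphere 0 1))
        (\<lambda>x. x /\<^sub>R norm x))"

lemma spherical_lebesgue_eq: "spherical_lebesgue = completion sphere_measure"
  by (simp add: spherical_lebesgue_def sphere_measure_def)

lemma sets_sphere_measure: "sets sphere_measure = sets (restrict_space borel (sphere 0 1))"
  by (simp add: sphere_measure_def)

lemma space_sphere_measure: "space sphere_measure = sphere 0 1"
  by (simp add: sphere_measure_def space_scale_measure space_restrict_space)

lemma normalize_measurable:
  "(\<lambda>x::'a::euclidean_space. x /\<^sub>R norm x) \<in>
     measurable (restrict_space lborel (cball 0 1 - {0})) (restrict_space borel (sphere 0 1))"
proof (rule measurable_restrict_space2)
  show "(\<lambda>x::'a. x /\<^sub>R norm x) \<in> measurable (restrict_space lborel (cball 0 1 - {0})) borel"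
    by (intro measurable_restrict_space1) measurable
qed (auto simp: space_restrict_space)

lemma emeasure_sphere_measure:
  fixes E :: "'a::euclidean_space set"
  assumes "E \<in> sets sphere_measure"
  shows "emeasure sphere_measure E =
    of_nat DIM('a) * emeasure lborel {x \<in> cball 0 1 - {0}. x /\<^sub>R norm x \<in> E}"
proof -
  have E: "E \<in> sets (restrict_space borel (sphere 0 1))" using assms by (simp add: sets_sphere_measure)
  have "cball 0 1 - {0::'a} \<in> sets lborel" by simp
  then show ?thesis
    unfolding sphere_measure_def emeasure_scale_measure emeasure_distr[OF normalize_measurable E]
    by (subst emeasure_restrict_space)
      (auto simp: space_restrict_space intro!: arg_cong2[of _ _ _ _ "(*)"] arg_cong[of _ _ "emeasure lborel"])
qed

lemma finite_measure_sphere_measure: "finite_measure (sphere_measure :: 'a::euclidean_space measure)"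
proof (rule finite_measureI)
  have "emeasure lborel {x \<in> cball 0 1 - {0}. x /\<^sub>R norm x \<in> sphere (0::'a) 1} \<le> emeasure lborel (cball (0::'a) 1)"
    by (intro emeasure_mono) auto
  also have "\<dots> < \<infinity>" by (intro emeasure_bounded_finite) auto
  finally have "emeasure lborel {x \<in> cball 0 1 - {0}. x /\<^sub>R norm x \<in> sphere (0::'a) 1} < \<infinity>" .
  moreover have "sphere (0::'a) 1 \<in> sets sphere_measure"
    using sets.top[of "sphere_measure :: 'a measure"] by (simp add: space_sphere_measure)
  ultimately show "emeasure sphere_measure (space (sphere_measure :: 'a measure)) \<noteq> \<infinity>"
    by (simp add: space_sphere_measure emeasure_sphere_measure ennreal_mult_eq_top_iff less_top[symmetric])
qed

text \<open>If x / |x| lies in S, so does x; the part of the ball that defines the spherical measure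
  is thus contained in the null set S.\<close>

lemma sphere_measure_null_of_cone:
  fixes S :: "'a::euclidean_space set"
  assumes S: "S \<in> null_sets lborel" and cone: "\<And>x s. x \<in> S \<Longrightarrow> s > 0 \<Longrightarrow> s *\<^sub>R x \<in> S"
  shows "sphere 0 1 \<inter> S \<in> null_sets sphere_measure"
proof -
  have meas: "sphere 0 1 \<inter> S \<in> sets sphere_measure"
    using null_setsD2[OF S] unfolding sets_sphere_measure sets_restrict_space by (intro image_eqI[of _ _ S]) simp_all
  have "{x \<in> cball 0 1 - {0}. x /\<^sub>R norm x \<in> sphere 0 1 \<inter> S} \<subseteq> S"
  proof
    fix x assume x: "x \<in> {x \<in> cball 0 1 - {0}. x /\<^sub>R norm x \<in> sphere 0 1 \<inter> S}"
    then show "x \<in> S" using cone[of "x /\<^sub>R norm x" "norm x"] by simp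
  qed
  then have "emeasure lborel {x \<in> cball 0 1 - {0}. x /\<^sub>R norm x \<in> sphere 0 1 \<inter> S} = 0"
    by (rule emeasure_eq_0[OF null_setsD2[OF S] null_setsD1[OF S]])
  then show ?thesis using meas by (simp add: null_sets_def emeasure_sphere_measure)
qed

text \<open>The part of the punctured unit ball over these directions contains the nonempty open set
  D, which is not negligible.\<close>

lemma emeasure_sphere_measure_cone_pos:
  fixes C :: "'a::euclidean_space set"
  assumes C: "closed C" "cone C" "interior C \<noteq> {}"
  shows "emeasure sphere_measure (C \<inter> sphere 0 1) \<noteq> 0"
proof
  assume 0: "emeasure sphere_measure (C \<inter> sphere 0 1) = 0"
  have meas: "C \<inter> sphere 0 1 \<in> sets sphere_measure"
    using C(1) unfolding sets_sphere_measure sets_restrict_space by (intro image_eqI[of _ _ C]) auto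
  define D where "D = interior C \<inter> (ball 0 1 - {0})"
  have D: "open D" unfolding D_def by (intro open_Int open_Diff) auto
  have "D \<noteq> {}"
  proof -
    have "interior C \<noteq> {0}" using not_open_singleton[of "0::'a"] open_interior[of C] by metis
    then obtain x where x: "x \<in> interior C" "x \<noteq> 0" using C(3) by blast
    \<comment> \<open>Scales x to norm 1 / 2, hence into the punctured ball.\<close>
    define r where "r = 1 / (2 * norm x)"
    have r: "r > 0" using x by (simp add: r_def)
    have "(*\<^sub>R) r ` interior C \<subseteq> C"
    proof (rule image_subsetI)
      fix z assume "z \<in> interior C"
      then have "z \<in> C" using interior_subset by blast
      then show "r *\<^sub>R z \<in> C" using C(2) r by (simp add: cone_def)
    qed
    moreover have "open ((*\<^sub>R) r ` interior C)" using r by (intro open_scaling) auto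
    ultimately have "r *\<^sub>R x \<in> interior C" using x(1) by (meson imageI interior_maximal subsetD)
    moreover have "norm (r *\<^sub>R x) = 1 / 2" using x(2) by (simp add: r_def)
    ultimately have "r *\<^sub>R x \<in> D" unfolding D_def using x(2) r by simp
    then show ?thesis by blast
  qed
  have "D \<subseteq> {x \<in> cball 0 1 - {0}. x /\<^sub>R norm x \<in> C \<inter> sphere 0 1}"
    using interior_subset[of C] C(2) by (auto simp: D_def cone_def)
  moreover have "{x \<in> cball 0 1 - {0}. x /\<^sub>R norm x \<in> C \<inter> sphere 0 1} =
      {x \<in> space (restrict_space lborel (cball 0 1 - {0})). x /\<^sub>R norm x \<in> C \<inter> sphere 0 1}"
    by (simp add: space_restrict_space)
  moreover have "\<dots> \<in> sets (restrict_space lborel (cball 0 1 - {0}))"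
    using measurable_sets[OF normalize_measurable, of "C \<inter> sphere 0 1"] meas
    by (simp add: sets_sphere_measure vimage_def Int_def conj_commute)
  ultimately have "emeasure lborel D \<le> emeasure lborel {x \<in> cball 0 1 - {0}. x /\<^sub>R norm x \<in> C \<inter> sphere 0 1}"
    by (intro emeasure_mono) (auto simp: sets_restrict_space_iff)
  also have "\<dots> = 0" using 0 meas by (simp add: emeasure_sphere_measure)
  finally have "emeasure lborel D = 0" by simp
  then have "negligible D" using D by (simp add: negligible_iff_null_sets null_sets_def emeasure_completion)
  then show False using open_not_negligible[OF D \<open>D \<noteq> {}\<close>] by simp
qed

section \<open>Wulff shapes in a cone\<close>

text \<open>A small step from u in the direction x stays in the polar cone and raises the inner
  product with x by a positive amount.\<close>

lemma inner_interior_polar_cone_neg: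
  assumes u: "u \<in> interior (polar_cone C)" and x: "x \<in> C" "x \<noteq> 0"
  shows "u \<bullet> x < 0"
proof -
  obtain e where e: "e > 0" "cball u e \<subseteq> polar_cone C" using u by (meson mem_interior_cball)
  have "u + (e / norm x) *\<^sub>R x \<in> cball u e" using e(1) x by (simp add: dist_norm)
  then have "u + (e / norm x) *\<^sub>R x \<in> polar_cone C" using e(2) by blast
  then have "(u + (e / norm x) *\<^sub>R x) \<bullet> x \<le> 0" using x by (simp add: polar_cone_def)
  then have "u \<bullet> x + (e / norm x) * (x \<bullet> x) \<le> 0" by (simp add: inner_add_left)
  moreover have "(e / norm x) * (x \<bullet> x) > 0" using e(1) x by simp
  ultimately show ?thesis by linarith
qed

locale cone_with_directions =
  fixes C \<omega> :: "'a::euclidean_space set"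
  assumes cone_C: "pointed_closed_convex_cone C"
    and compact_omega: "compact \<omega>" and omega_subset: "\<omega> \<subseteq> Omega (polar_cone C)"
    and omega_nonempty: "\<omega> \<noteq> {}"
begin

definition rays :: "'a set" where "rays = C \<inter> sphere 0 1"

definition cost :: "'a \<Rightarrow> 'a \<Rightarrow> real" where "cost u v = ln (- (u \<bullet> v))"

lemma inner_neg: "u \<in> Omega (polar_cone C) \<Longrightarrow> x \<in> C \<Longrightarrow> x \<noteq> 0 \<Longrightarrow> u \<bullet> x < 0"
  by (auto simp: Omega_def intro: inner_interior_polar_cone_neg)

lemma inner_rays_neg: "u \<in> Omega (polar_cone C) \<Longrightarrow> v \<in> rays \<Longrightarrow> u \<bullet> v < 0"
  by (rule inner_neg) (auto simp: rays_def)

lemma closed_C: "closed C" and convex_C: "convex C" and conic_C: "cone C"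
  using cone_C by (auto simp: pointed_closed_convex_cone_def)

lemma scaleR_C: "x \<in> C \<Longrightarrow> 0 \<le> r \<Longrightarrow> r *\<^sub>R x \<in> C"
  using conic_C by (simp add: cone_def)

lemma emeasure_rays: "emeasure sphere_measure rays \<noteq> 0"
  unfolding rays_def using cone_C
  by (intro emeasure_sphere_measure_cone_pos) (auto simp: pointed_closed_convex_cone_def)

lemma rays_sets: "rays \<in> sets sphere_measure"
  unfolding rays_def sets_sphere_measure sets_restrict_space
  using closed_C by (intro image_eqI[of _ _ C]) auto

sublocale dual_problem \<omega> rays cost
proof
  show "compact rays" unfolding rays_def using closed_C by (intro closed_Int_compact) auto
  show "rays \<noteq> {}" using emeasure_rays by auto
  have "continuous_on (\<omega> \<times> rays) (\<lambda>x. ln (- (fst x \<bullet> snd x)))"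
    using inner_rays_neg omega_subset by (intro continuous_intros) fastforce+
  then show "continuous_on (\<omega> \<times> rays) (\<lambda>(u, v). cost u v)" by (simp add: cost_def case_prod_unfold)
qed (fact compact_omega omega_nonempty)+

text \<open>Here exp (\<phi> u) is only a lower bound for minus the support function; equality holds
  for those u that are maximal for some ray.\<close>

definition wulff :: "('a \<Rightarrow> real) \<Rightarrow> 'a set" where
  "wulff \<phi> = C \<inter> (\<Inter>u\<in>\<omega>. lower_halfspace u (- exp (\<phi> u)))"

lemma wulff_le: "x \<in> wulff \<phi> \<Longrightarrow> u \<in> \<omega> \<Longrightarrow> x \<bullet> u \<le> - exp (\<phi> u)"
  by (auto simp: wulff_def lower_halfspace_def)

lemma wulff_subset: "wulff \<phi> \<subseteq> C"
  by (simp add: wulff_def)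

lemma zero_notin_wulff: "0 \<notin> wulff \<phi>"
  using wulff_le[of 0 \<phi>] omega_nonempty by (metis all_not_in_conv exp_gt_zero inner_zero_left neg_0_le_iff_le not_less)

lemma closed_wulff: "closed (wulff \<phi>)"
  unfolding wulff_def lower_halfspace_def
  by (intro closed_Int closed_INT ballI closed_C closed_Collect_le continuous_intros)

lemma convex_wulff: "convex (wulff \<phi>)"
proof -
  have "convex (lower_halfspace u a)" for u :: 'a and a
    using convex_halfspace_le[of u a] by (simp add: lower_halfspace_def inner_commute)
  then show ?thesis unfolding wulff_def by (intro convex_Int convex_INT convex_C)
qed

text \<open>Taking logarithms turns each half-space condition on r v into
  \<open>\<phi> u - cost u v <= ln r\<close>.\<close>

lemma scaleR_in_wulff_iff:
  assumes \<phi>: "continuous_on \<omega> \<phi>" and v: "v \<in> rays" and r: "r > 0"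
  shows "r *\<^sub>R v \<in> wulff \<phi> \<longleftrightarrow> exp (ctrans \<phi> v) \<le> r"
proof -
  have *: "(r *\<^sub>R v) \<bullet> u \<le> - exp (\<phi> u) \<longleftrightarrow> \<phi> u - cost u v \<le> ln r" if "u \<in> \<omega>" for u
  proof -
    have neg: "- (u \<bullet> v) > 0" using that v inner_rays_neg omega_subset by force
    have "(r *\<^sub>R v) \<bullet> u \<le> - exp (\<phi> u) \<longleftrightarrow> exp (\<phi> u) \<le> r * (- (u \<bullet> v))"
      by (simp add: inner_commute) linarith
    also have "\<dots> \<longleftrightarrow> \<phi> u \<le> ln (r * (- (u \<bullet> v)))"
      using neg r by (intro ln_ge_iff[symmetric] mult_pos_pos)
    also have "ln (r * (- (u \<bullet> v))) = ln r + cost u v"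
      unfolding cost_def using neg r by (intro ln_mult_pos)
    finally show ?thesis by linarith
  qed
  have "r *\<^sub>R v \<in> C" using v r scaleR_C by (simp add: rays_def)
  then have "r *\<^sub>R v \<in> wulff \<phi> \<longleftrightarrow> (\<forall>u\<in>\<omega>. \<phi> u - cost u v \<le> ln r)"
    using * by (auto simp: wulff_def lower_halfspace_def)
  also have "\<dots> \<longleftrightarrow> ctrans \<phi> v \<le> ln r"
    using ctrans_le[OF \<phi> v] ctrans_ge[OF \<phi> _ v] by (meson order_trans)
  also have "\<dots> \<longleftrightarrow> exp (ctrans \<phi> v) \<le> r" using r by (rule ln_ge_iff)
  finally show ?thesis .
qed

lemma boundary_point_in_wulff:
  "continuous_on \<omega> \<phi> \<Longrightarrow> v \<in> rays \<Longrightarrow> exp (ctrans \<phi> v) *\<^sub>R v \<in> wulff \<phi>"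
  by (simp add: scaleR_in_wulff_iff)

lemma radial_fun_wulff:
  assumes \<phi>: "continuous_on \<omega> \<phi>" and v: "v \<in> rays"
  shows "radial_fun C (wulff \<phi>) v = exp (ctrans \<phi> v)"
proof -
  have "{r. r > 0 \<and> r *\<^sub>R v \<in> C - wulff \<phi>} = {0<..<exp (ctrans \<phi> v)}"
    using scaleR_in_wulff_iff[OF \<phi> v] scaleR_C v by (auto simp: rays_def not_le)
  then show ?thesis unfolding radial_fun_def by (simp add: cSup_greaterThanLessThan)
qed

lemma normalized_in_rays: "x \<in> C \<Longrightarrow> x \<noteq> 0 \<Longrightarrow> x /\<^sub>R norm x \<in> rays"
  unfolding rays_def using scaleR_C by simp

text \<open>Compatibility holds because the defining half-spaces are among those intersected; C
  minus the shape is bounded because the transform is bounded on the compact set of rays.\<close>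

lemma C_full_wulff:
  assumes \<phi>: "continuous_on \<omega> \<phi>"
  shows "C_full C (wulff \<phi>)"
  unfolding C_full_def C_compatible_def
proof (intro conjI)
  obtain v where v: "v \<in> rays" using V_nonempty by blast
  show "\<not> bounded (wulff \<phi>)"
  proof
    assume "bounded (wulff \<phi>)"
    then obtain b where b: "\<And>x. x \<in> wulff \<phi> \<Longrightarrow> norm x \<le> b" unfolding bounded_iff by blast
    define r where "r = max (exp (ctrans \<phi> v)) (\<bar>b\<bar> + 1)"
    have "r > 0" by (simp add: r_def less_max_iff_disj)
    then have "r *\<^sub>R v \<in> wulff \<phi>" by (simp add: scaleR_in_wulff_iff[OF \<phi> v]) (simp add: r_def)
    from b[OF this] have "r \<le> b" using \<open>r > 0\<close> v by (simp add: rays_def)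
    moreover have "\<bar>b\<bar> + 1 \<le> r" by (simp add: r_def)
    ultimately show False by linarith
  qed
  show "wulff \<phi> = C \<inter> \<Inter> {lower_halfspace u a |u a.
      u \<in> Omega (polar_cone C) \<and> wulff \<phi> \<subseteq> lower_halfspace u a}"
  proof (intro equalityI subsetI)
    fix x assume x: "x \<in> C \<inter> \<Inter> {lower_halfspace u a |u a.
      u \<in> Omega (polar_cone C) \<and> wulff \<phi> \<subseteq> lower_halfspace u a}"
    have "x \<in> lower_halfspace u (- exp (\<phi> u))" if "u \<in> \<omega>" for u
    proof -
      have "wulff \<phi> \<subseteq> lower_halfspace u (- exp (\<phi> u))" using that by (auto simp: wulff_def)
      then show ?thesis using x that omega_subset by blast
    qed
    then show "x \<in> wulff \<phi>" using x by (simp add: wulff_def)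
  qed (use wulff_subset in blast)
  obtain B where B: "\<And>v. v \<in> rays \<Longrightarrow> \<bar>ctrans \<phi> v\<bar> \<le> B"
    using compact_continuous_bounded[OF compact_V continuous_ctrans[OF \<phi>]] by metis
  have "norm x \<le> exp B" if x: "x \<in> C - wulff \<phi>" for x
  proof (cases "x = 0")
    case False
    have v: "x /\<^sub>R norm x \<in> rays" using x False by (intro normalized_in_rays) auto
    have "\<not> exp (ctrans \<phi> (x /\<^sub>R norm x)) \<le> norm x"
      using scaleR_in_wulff_iff[OF \<phi> v, of "norm x"] x False by simp
    also have "exp (ctrans \<phi> (x /\<^sub>R norm x)) \<le> exp B" using B[OF v] by simp
    ultimately show ?thesis by linarith
  qed simp
  then show "bounded (C - wulff \<phi>)" unfolding bounded_iff by blast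
qed (fact closed_wulff convex_wulff wulff_subset zero_notin_wulff)+

text \<open>Along every ray, also one in the boundary of C, the boundary point of the shape is a
  limit of points s v with s < \<rho>, which lie in C but outside the shape.\<close>

lemma Omega_e_wulff:
  assumes \<phi>: "continuous_on \<omega> \<phi>"
  shows "Omega_e C (wulff \<phi>) = rays"
proof (intro equalityI subsetI)
  fix v assume "v \<in> Omega_e C (wulff \<phi>)"
  then obtain x where x: "x \<in> frontier (wulff \<phi>)" "v = x /\<^sub>R norm x"
    unfolding Omega_e_def effective_boundary_def by blast
  have "x \<in> wulff \<phi>" using x(1) frontier_subset_closed[OF closed_wulff] by blast
  then have "x \<in> C" "x \<noteq> 0" using wulff_subset zero_notin_wulff by auto
  then show "v \<in> rays" using x(2) normalized_in_rays by simp
next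
  fix v assume v: "v \<in> rays"
  define \<rho> where "\<rho> = exp (ctrans \<phi> v)"
  have \<rho>: "\<rho> > 0" and nv: "norm v = 1" using v by (simp_all add: \<rho>_def rays_def)
  define x where "x = \<rho> *\<^sub>R v"
  have xA: "x \<in> wulff \<phi>" unfolding x_def \<rho>_def by (rule boundary_point_in_wulff[OF \<phi> v])
  have xcl: "x \<in> closure (C - wulff \<phi>)"
    unfolding closure_approachable
  proof (intro allI impI)
    fix e :: real assume e: "e > 0"
    define s where "s = max (\<rho> / 2) (\<rho> - e / 2)"
    have s: "0 < s" "s < \<rho>" "\<rho> - s < e" using e \<rho> by (auto simp: s_def)
    have "s *\<^sub>R v \<in> C - wulff \<phi>"
      using scaleR_in_wulff_iff[OF \<phi> v s(1)] s scaleR_C v by (simp add: \<rho>_def rays_def)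
    moreover have "dist (s *\<^sub>R v) x < e"
    proof -
      have "s *\<^sub>R v - x = (s - \<rho>) *\<^sub>R v" by (simp add: x_def scaleR_left_diff_distrib)
      then show ?thesis using s nv by (simp add: dist_norm)
    qed
    ultimately show "\<exists>y\<in>C - wulff \<phi>. dist y x < e" by blast
  qed
  \<comment> \<open>An open set disjoint from a set is disjoint from its closure, so x cannot be
    interior to the shape.\<close>
  have "interior (wulff \<phi>) \<inter> (C - wulff \<phi>) = {}" using interior_subset by blast
  then have "interior (wulff \<phi>) \<inter> closure (C - wulff \<phi>) = {}"
    by (simp add: open_Int_closure_eq_empty)
  then have "x \<notin> interior (wulff \<phi>)" using xcl by blast
  moreover have "x \<notin> interior (C - wulff \<phi>)" using xA interior_subset by blast
  ultimately have "x \<in> effective_boundary C (wulff \<phi>)"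
    using xA xcl closure_subset unfolding effective_boundary_def frontier_def by blast
  moreover have "v = x /\<^sub>R norm x" using \<rho> nv by (simp add: x_def)
  ultimately show "v \<in> Omega_e C (wulff \<phi>)" unfolding Omega_e_def by blast
qed

lemma bdd_above_inner_wulff:
  assumes "u \<in> Omega (polar_cone C)"
  shows "bdd_above ((\<lambda>x. x \<bullet> u) ` wulff \<phi>)"
proof (rule bdd_aboveI2)
  fix x assume "x \<in> wulff \<phi>"
  then have "x \<in> C" "x \<noteq> 0" using wulff_subset zero_notin_wulff by auto
  then show "x \<bullet> u \<le> 0" using inner_neg[OF assms, of x] by (simp add: inner_commute)
qed

lemma wulff_nonempty:
  assumes "continuous_on \<omega> \<phi>" shows "wulff \<phi> \<noteq> {}"
  using boundary_point_in_wulff[OF assms] V_nonempty by blast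

text \<open>If u is maximal for v, the boundary point on the ray v lies on the hyperplane that
  bounds the constraint u, so the prescribed support value is attained.\<close>

lemma support_fun_active:
  assumes \<phi>: "continuous_on \<omega> \<phi>" and v: "v \<in> rays" and u: "u \<in> \<omega>" "ctrans \<phi> v = \<phi> u - cost u v"
  shows "exp (ctrans \<phi> v) * (v \<bullet> u) = - exp (\<phi> u)" "support_fun (wulff \<phi>) u = - exp (\<phi> u)"
proof -
  have "- (u \<bullet> v) > 0" using u v inner_rays_neg omega_subset by force
  then show *: "exp (ctrans \<phi> v) * (v \<bullet> u) = - exp (\<phi> u)"
  proof -
    have "exp (\<phi> u) = exp (ctrans \<phi> v) * exp (cost u v)" using u(2) by (simp flip: exp_add)
    also have "exp (cost u v) = - (u \<bullet> v)" using \<open>- (u \<bullet> v) > 0\<close> by (simp add: cost_def)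
    finally show ?thesis by (simp add: inner_commute)
  qed
  show "support_fun (wulff \<phi>) u = - exp (\<phi> u)"
    unfolding support_fun_def
  proof (rule cSup_eq_maximum)
    show "- exp (\<phi> u) \<in> (\<lambda>x. x \<bullet> u) ` wulff \<phi>"
      using * by (intro image_eqI[OF _ boundary_point_in_wulff[OF \<phi> v]]) simp
  qed (use wulff_le u in auto)
qed

lemma reverse_radial_Gauss_image_wulff:
  assumes \<phi>: "continuous_on \<omega> \<phi>"
  shows "reverse_radial_Gauss_image C (wulff \<phi>) \<eta> =
    {v \<in> rays. \<exists>u\<in>\<eta>. exp (ctrans \<phi> v) * (v \<bullet> u) = support_fun (wulff \<phi>) u}"
  unfolding reverse_radial_Gauss_image_def Omega_e_wulff[OF \<phi>] hyperplane_def
  by (auto simp: radial_fun_wulff[OF \<phi>])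

lemma scaled_normals_wulff:
  assumes \<phi>: "continuous_on \<omega> \<phi>" and v: "v \<in> rays" and u: "u \<in> Omega (polar_cone C)"
    and eq: "exp (ctrans \<phi> v) * (v \<bullet> u) = support_fun (wulff \<phi>) u"
  shows "u /\<^sub>R (exp (ctrans \<phi> v) * (v \<bullet> u)) \<in> scaled_normals (wulff \<phi>) (exp (ctrans \<phi> v) *\<^sub>R v)"
proof -
  have neg: "exp (ctrans \<phi> v) * (v \<bullet> u) < 0"
    using inner_rays_neg[OF u v] by (simp add: inner_commute mult_pos_neg)
  have "1 \<le> (u /\<^sub>R (exp (ctrans \<phi> v) * (v \<bullet> u))) \<bullet> y" if "y \<in> wulff \<phi>" for y
  proof -
    have "y \<bullet> u \<le> exp (ctrans \<phi> v) * (v \<bullet> u)"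
      unfolding eq support_fun_def using that bdd_above_inner_wulff[OF u] by (rule cSUP_upper)
    then have "1 \<le> (y \<bullet> u) / (exp (ctrans \<phi> v) * (v \<bullet> u))" using neg by (simp add: neg_le_divide_eq)
    then show ?thesis by (simp add: inner_commute divide_inverse_commute)
  qed
  moreover have "(u /\<^sub>R (exp (ctrans \<phi> v) * (v \<bullet> u))) \<bullet> (exp (ctrans \<phi> v) *\<^sub>R v) = 1"
    using neg by (auto simp: inner_commute field_simps)
  ultimately show ?thesis by (simp add: scaled_normals_def)
qed

text \<open>Off the singular cone the two scaled normals agree; as u and u' have norm 1, the scaling
  factors agree in absolute value, and both are negative.\<close>

lemma unique_normal:
  assumes \<phi>: "continuous_on \<omega> \<phi>" and v: "v \<in> rays" "v \<notin> singular_cone (wulff \<phi>)"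
    and u: "u \<in> Omega (polar_cone C)" "exp (ctrans \<phi> v) * (v \<bullet> u) = support_fun (wulff \<phi>) u"
    and u': "u' \<in> Omega (polar_cone C)" "exp (ctrans \<phi> v) * (v \<bullet> u') = support_fun (wulff \<phi>) u'"
  shows "u = u'"
proof -
  let ?a = "exp (ctrans \<phi> v) * (v \<bullet> u)" and ?a' = "exp (ctrans \<phi> v) * (v \<bullet> u')"
  have neg: "?a < 0" "?a' < 0"
    using inner_rays_neg[OF u(1) v(1)] inner_rays_neg[OF u'(1) v(1)] by (simp_all add: inner_commute mult_pos_neg)
  have eq: "u /\<^sub>R ?a = u' /\<^sub>R ?a'"
  proof (rule ccontr)
    assume "u /\<^sub>R ?a \<noteq> u' /\<^sub>R ?a'"
    moreover have "v = exp (- ctrans \<phi> v) *\<^sub>R (exp (ctrans \<phi> v) *\<^sub>R v)" by (simp add: exp_minus)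
    ultimately have "v \<in> singular_cone (wulff \<phi>)"
      unfolding singular_cone_def
      using boundary_point_in_wulff[OF \<phi> v(1)] scaled_normals_wulff[OF \<phi> v(1) u] scaled_normals_wulff[OF \<phi> v(1) u']
        exp_gt_zero by blast
    with v(2) show False by simp
  qed
  have norm: "norm (w /\<^sub>R r) = inverse \<bar>r\<bar>" if "w \<in> Omega (polar_cone C)" for w r
    using that by (simp add: Omega_def)
  have "inverse \<bar>?a\<bar> = inverse \<bar>?a'\<bar>"
    using arg_cong[OF eq, of norm] unfolding norm[OF u(1)] norm[OF u'(1)] .
  then have "\<bar>?a\<bar> = \<bar>?a'\<bar>" by (rule inverse_eq_imp_eq)
  then have "?a = ?a'" using neg by linarith
  then show ?thesis using eq neg by auto
qed

end

text \<open>A supremum of linear functions is lower semicontinuous: its strict superlevel sets are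
  relatively open.\<close>

lemma borel_measurable_support_fun:
  fixes A \<Omega> :: "'a::euclidean_space set"
  assumes "A \<noteq> {}" "\<And>u. u \<in> \<Omega> \<Longrightarrow> bdd_above ((\<lambda>x. x \<bullet> u) ` A)"
  shows "support_fun A \<in> borel_measurable (restrict_space borel \<Omega>)"
proof (rule borel_measurableI_greater)
  fix y :: real
  have "{u \<in> space (restrict_space borel \<Omega>). y < support_fun A u} =
      \<Omega> \<inter> (\<Union>x\<in>A. {u. y < x \<bullet> u})"
    using less_cSUP_iff[OF assms] by (auto simp: space_restrict_space support_fun_def)
  moreover have "open (\<Union>x\<in>A. {u. y < x \<bullet> u})"
    by (intro open_UN ballI open_Collect_less continuous_intros)
  then have "(\<Union>x\<in>A. {u. y < x \<bullet> u}) \<in> sets borel" by (rule borel_open)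
  ultimately show "{u \<in> space (restrict_space borel \<Omega>). y < support_fun A u} \<in>
      sets (restrict_space borel \<Omega>)"
    unfolding sets_restrict_space by simp
qed

section \<open>The dual curvature measure of a Wulff shape as a pushforward\<close>

context cone_with_directions begin

definition ray_measure :: "'a measure" where
  "ray_measure = restrict_space sphere_measure rays"

lemma sets_ray_measure: "sets ray_measure = sets (restrict_space borel rays)"
proof -
  have "sphere 0 1 \<inter> rays = rays" by (auto simp: rays_def)
  then show ?thesis
    unfolding ray_measure_def sets_restrict_space_cong[OF sets_sphere_measure] sets_restrict_restrict_space
    by simp
qed

lemma rays_Int_space: "rays \<inter> space sphere_measure = rays"
  by (auto simp: rays_def space_sphere_measure)

lemma space_ray_measure: "space ray_measure = rays"
  unfolding ray_measure_def space_restrict_space by (rule rays_Int_space)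

lemma nonzero_finite_ray_measure: "nonzero_finite_measure ray_measure"
proof -
  have "finite_measure ray_measure"
    unfolding ray_measure_def
    by (intro finite_measure_restrict_space finite_measure_sphere_measure rays_sets)
  moreover have "emeasure ray_measure (space ray_measure) \<noteq> 0"
    unfolding space_ray_measure using emeasure_rays
    by (simp add: ray_measure_def emeasure_restrict_space rays_Int_space rays_sets)
  ultimately show ?thesis
    by (simp add: nonzero_finite_measure_def nonzero_finite_measure_axioms_def)
qed

lemma AE_ray_measure_iff: "(AE v in ray_measure. P v) \<longleftrightarrow> (AE v in sphere_measure. v \<in> rays \<longrightarrow> P v)"
  unfolding ray_measure_def by (rule AE_restrict_space_iff) (simp add: rays_Int_space rays_sets)

lemma AE_not_singular: "AE v in ray_measure. v \<notin> singular_cone (wulff \<phi>)"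
proof -
  let ?S = "singular_cone (wulff \<phi>)"
  have "sphere 0 1 \<inter> ?S \<in> null_sets sphere_measure"
  proof (rule sphere_measure_null_of_cone)
    show "?S \<in> null_sets lborel" by (rule singular_cone_null[OF closed_wulff])
    fix x :: 'a and r :: real assume "x \<in> ?S" "r > 0"
    then obtain s y where "x = s *\<^sub>R y" "s > 0" "y \<in> wulff \<phi>"
      and y: "\<exists>w\<in>scaled_normals (wulff \<phi>) y. \<exists>w'\<in>scaled_normals (wulff \<phi>) y. w \<noteq> w'"
      unfolding singular_cone_def by blast
    then have "r *\<^sub>R x = (r * s) *\<^sub>R y" "r * s > 0" "y \<in> wulff \<phi>" using \<open>r > 0\<close> by simp_all
    then show "r *\<^sub>R x \<in> ?S" using y unfolding singular_cone_def by blast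
  qed
  then have "AE v in sphere_measure. v \<notin> sphere 0 1 \<inter> ?S" by (rule AE_not_in)
  then show ?thesis unfolding AE_ray_measure_iff by (rule AE_mp) (auto simp: rays_def)
qed

lemma unique_max_ex:
  assumes \<phi>: "continuous_on \<omega> \<phi>" and v: "v \<in> rays" "v \<notin> singular_cone (wulff \<phi>)"
  shows "\<exists>u. unique_max \<phi> v u"
proof -
  obtain u where u: "u \<in> \<omega>" "ctrans \<phi> v = \<phi> u - cost u v"
    and le: "\<And>u'. u' \<in> \<omega> \<Longrightarrow> \<phi> u' - cost u' v \<le> ctrans \<phi> v"
    using ctrans_max[OF \<phi> v(1)] by metis
  have normal: "w \<in> Omega (polar_cone C) \<and> exp (ctrans \<phi> v) * (v \<bullet> w) = support_fun (wulff \<phi>) w"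
    if "w \<in> \<omega>" "ctrans \<phi> v = \<phi> w - cost w v" for w
    using support_fun_active[OF \<phi> v(1) that] that omega_subset by auto
  have "\<phi> w - cost w v < \<phi> u - cost u v" if w: "w \<in> \<omega>" "w \<noteq> u" for w
  proof (rule ccontr)
    assume "\<not> ?thesis"
    then have "ctrans \<phi> v = \<phi> w - cost w v" using le[OF w(1)] u by linarith
    then have "w = u" using normal w(1) u unique_normal[OF \<phi> v] by blast
    with w show False by simp
  qed
  with u(1) show ?thesis unfolding unique_max_def by blast
qed

text \<open>The set \<eta> may contain directions outside \<omega>, so uniqueness of the maximiser
  within \<omega> would not suffice; the point has no other normal in the whole polar
  region.\<close>

lemma mem_reverse_radial_Gauss_image_iff:
  assumes \<phi>: "continuous_on \<omega> \<phi>" and v: "v \<in> rays" "v \<notin> singular_cone (wulff \<phi>)"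
    and max: "unique_max \<phi> v u" and \<eta>: "\<eta> \<subseteq> Omega (polar_cone C)"
  shows "v \<in> reverse_radial_Gauss_image C (wulff \<phi>) \<eta> \<longleftrightarrow> u \<in> \<eta>"
proof -
  have u: "u \<in> \<omega>" using max by (simp add: unique_max_def)
  have act: "exp (ctrans \<phi> v) * (v \<bullet> u) = support_fun (wulff \<phi>) u"
    using support_fun_active[OF \<phi> v(1) u unique_max_ctrans[OF \<phi> v(1) max]] by simp
  show ?thesis
    unfolding reverse_radial_Gauss_image_wulff[OF \<phi>] mem_Collect_eq
    using act v(1) \<eta> u omega_subset unique_normal[OF \<phi> v _ _ _ act] by blast
qed

text \<open>Up to a null set the reverse radial Gauss image of \<eta> is the preimage of \<eta>
  under T, so the curvature set function agrees with a pushforward on Borel sets.\<close>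

lemma dual_curvature_measure_wulff:
  fixes q :: real
  assumes \<phi>: "continuous_on \<omega> \<phi>" and T: "T \<in> measurable ray_measure (restrict_space borel \<omega>)"
    and max: "AE v in ray_measure. unique_max \<phi> v (T v)"
  defines "k \<equiv> if q = 0 then 1 else 1 / real DIM('a)"
  shows "dual_curvature_measure q C (wulff \<phi>) =
    distr (density ray_measure (\<lambda>v. ennreal (k * exp (q * ctrans \<phi> v))))
      (restrict_space borel (Omega (polar_cone C))) T" (is "_ = ?D")
proof -
  let ?\<Omega> = "Omega (polar_cone C)" and ?A = "wulff \<phi>"
  have meas: "(\<lambda>v. ennreal (exp (q * ctrans \<phi> v))) \<in> borel_measurable ray_measure"
    unfolding measurable_cong_sets[OF sets_ray_measure refl]
    by (intro measurable_compose[OF _ measurable_ennreal] borel_measurable_continuous_on_restrict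
        continuous_intros continuous_ctrans \<phi>)
  have k: "k \<ge> 0" by (simp add: k_def)
  have "T \<in> measurable ray_measure borel" and T_omega: "\<And>v. v \<in> rays \<Longrightarrow> T v \<in> \<omega>"
    using T by (simp_all add: measurable_restrict_space2_iff space_ray_measure Pi_iff)
  then have T\<Omega>: "T \<in> measurable ray_measure (restrict_space borel ?\<Omega>)"
    using omega_subset by (intro measurable_restrict_space2) (auto simp: space_ray_measure)
  have eq: "dual_curvature_fun q C ?A \<eta> = emeasure ?D \<eta>" if \<eta>: "\<eta> \<in> sets (restrict_space borel ?\<Omega>)" for \<eta>
  proof -
    have \<eta>\<Omega>: "\<eta> \<subseteq> ?\<Omega>" using sets.sets_into_space[OF \<eta>] by (simp add: space_restrict_space)
    define E where "E = T -` \<eta> \<inter> rays"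
    have E: "E \<in> sets ray_measure" using measurable_sets[OF T\<Omega> \<eta>] by (simp add: E_def space_ray_measure)
    define g where "g v = (if q = 0 then 1 else ennreal (radial_fun C ?A v powr q))" for v
    have "AE v in ray_measure. g v * indicator (reverse_radial_Gauss_image C ?A \<eta>) v =
        ennreal (exp (q * ctrans \<phi> v)) * indicator E v"
      using max AE_not_singular[of \<phi>]
    proof (rule AE_mp[OF _ AE_mp[OF _ AE_I2]], intro impI)
      fix v assume "v \<in> space ray_measure" "unique_max \<phi> v (T v)" "v \<notin> singular_cone ?A"
      moreover from this have "g v = ennreal (exp (q * ctrans \<phi> v))"
        by (auto simp: g_def space_ray_measure radial_fun_wulff[OF \<phi>] powr_def)
      ultimately show "g v * indicator (reverse_radial_Gauss_image C ?A \<eta>) v =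
          ennreal (exp (q * ctrans \<phi> v)) * indicator E v"
        using mem_reverse_radial_Gauss_image_iff[OF \<phi> _ _ _ \<eta>\<Omega>, of v "T v"]
        by (auto simp: space_ray_measure E_def indicator_def)
    qed
    \<comment> \<open>The Gauss image itself need not be Borel. Almost everywhere its indicator may
      be replaced by that of the Borel set E, and completing the measure does not change the
      integral.\<close>
    then have ae: "AE v in sphere_measure. g v * indicator (reverse_radial_Gauss_image C ?A \<eta>) v =
        ennreal (exp (q * ctrans \<phi> v)) * indicator E v * indicator rays v"
      unfolding AE_ray_measure_iff
      by (rule AE_mp) (auto intro!: AE_I2 simp: reverse_radial_Gauss_image_wulff[OF \<phi>] indicator_def)
    have "dual_curvature_fun q C ?A \<eta> =
        ennreal k * (\<integral>\<^sup>+ v. g v * indicator (reverse_radial_Gauss_image C ?A \<eta>) v \<partial>spherical_lebesgue)"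
      by (simp add: dual_curvature_fun_def k_def g_def)
    also have "\<dots> = ennreal k * (\<integral>\<^sup>+ v. ennreal (exp (q * ctrans \<phi> v)) * indicator E v * indicator rays v \<partial>sphere_measure)"
      unfolding spherical_lebesgue_eq nn_integral_completion nn_integral_cong_AE[OF ae] ..
    also have "\<dots> = ennreal k * (\<integral>\<^sup>+ v. ennreal (exp (q * ctrans \<phi> v)) * indicator E v \<partial>ray_measure)"
      unfolding ray_measure_def by (subst nn_integral_restrict_space) (simp_all add: rays_Int_space rays_sets)
    also have "\<dots> = (\<integral>\<^sup>+ v. ennreal k * (ennreal (exp (q * ctrans \<phi> v)) * indicator E v) \<partial>ray_measure)"
      using meas E by (intro nn_integral_cmult[symmetric]) auto
    also have "\<dots> = (\<integral>\<^sup>+ v. ennreal (k * exp (q * ctrans \<phi> v)) * indicator E v \<partial>ray_measure)"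
      using k by (simp add: ennreal_mult' mult.assoc)
    also have "\<dots> = emeasure (density ray_measure (\<lambda>v. ennreal (k * exp (q * ctrans \<phi> v)))) E"
      using meas E k by (intro emeasure_density[symmetric]) (simp_all add: ennreal_mult')
    also have "\<dots> = emeasure ?D \<eta>"
      using T\<Omega> \<eta> by (subst emeasure_distr) (auto simp: E_def space_ray_measure)
    finally show ?thesis .
  qed
  \<comment> \<open>\<open>measure_of\<close> depends only on the values on the sigma-algebra; as
    these are the values of the measure ?D, countable additivity comes for free.\<close>
  have "?D = measure_of (space ?D) (sets ?D) (emeasure ?D)" by (rule measure_of_of_measure[symmetric])
  also have "\<dots> = measure_of ?\<Omega> (sets (restrict_space borel ?\<Omega>)) (emeasure ?D)"
    by (simp add: space_restrict_space)
  also have "\<dots> = dual_curvature_measure q C ?A"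
    unfolding dual_curvature_measure_def
  proof (rule measure_of_eq)
    show "sets (restrict_space borel ?\<Omega>) \<subseteq> Pow ?\<Omega>"
      using sets.space_closed[of "restrict_space borel ?\<Omega>"] by (simp add: space_restrict_space)
    fix \<eta> assume "\<eta> \<in> sigma_sets ?\<Omega> (sets (restrict_space borel ?\<Omega>))"
    then have "\<eta> \<in> sets (restrict_space borel ?\<Omega>)"
      using sets.sigma_sets_eq[of "restrict_space borel ?\<Omega>"] by (simp add: space_restrict_space)
    then show "emeasure ?D \<eta> = dual_curvature_fun q C ?A \<eta>" by (rule eq[symmetric])
  qed
  finally show ?thesis by simp
qed

text \<open>The variational problem is solved for the restriction of \<mu> to \<omega>; the density
  exp (p \<phi>) found there is undone by the power -p of minus the support function.\<close>

theorem pq_dual_Minkowski_existence: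
  assumes "p \<noteq> q"
    and sets_\<mu>: "sets \<mu> = sets (restrict_space borel (Omega (polar_cone C)))"
    and fin: "finite_measure \<mu>" and nz: "emeasure \<mu> (space \<mu>) \<noteq> 0"
    and null: "emeasure \<mu> (space \<mu> - \<omega>) = 0"
  shows "\<exists>A. C_full C A \<and> \<mu> = pq_dual_curvature_measure p q C A"
proof -
  let ?\<Omega> = "Omega (polar_cone C)"
  have space_\<mu>: "space \<mu> = ?\<Omega>"
    using sets_eq_imp_space_eq[OF sets_\<mu>] by (simp add: space_restrict_space)
  have \<omega>_borel: "\<omega> \<in> sets borel" using compact_omega by (rule borel_compact)
  have \<omega>\<Omega>: "\<omega> \<inter> ?\<Omega> = \<omega>" "?\<Omega> \<inter> \<omega> = \<omega>" using omega_subset by auto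
  have \<omega>_sets: "\<omega> \<in> sets \<mu>"
    unfolding sets_\<mu> sets_restrict_space using \<omega>_borel \<omega>\<Omega> by (intro image_eqI[of _ _ \<omega>]) auto
  have emeasure_Int: "emeasure \<mu> (\<eta> \<inter> \<omega>) = emeasure \<mu> \<eta>" if "\<eta> \<in> sets \<mu>" for \<eta>
  proof -
    have "space \<mu> - \<omega> \<in> null_sets \<mu>" using \<omega>_sets null by (intro null_setsI) auto
    moreover have "\<eta> \<inter> \<omega> = \<eta> - (space \<mu> - \<omega>)" using sets.sets_into_space[OF that] by auto
    ultimately show ?thesis using that by (simp add: emeasure_Diff_null_set)
  qed
  define \<mu>0 where "\<mu>0 = restrict_space \<mu> \<omega>"
  have sets_\<mu>0: "sets \<mu>0 = sets (restrict_space borel \<omega>)"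
    unfolding \<mu>0_def sets_restrict_space_cong[OF sets_\<mu>] sets_restrict_restrict_space by (simp add: \<omega>\<Omega>)
  have emeasure_\<mu>0: "emeasure \<mu>0 E = emeasure \<mu> E" if "E \<subseteq> \<omega>" for E
    unfolding \<mu>0_def using that \<omega>_sets by (intro emeasure_restrict_space) (auto simp: space_\<mu> \<omega>\<Omega>)
  have space_\<mu>0: "space \<mu>0 = \<omega>" by (simp add: \<mu>0_def space_restrict_space space_\<mu> \<omega>\<Omega>)
  have "finite_measure \<mu>0"
    unfolding \<mu>0_def using fin \<omega>_sets by (rule finite_measure_restrict_space)
  moreover have "emeasure \<mu>0 (space \<mu>0) \<noteq> 0"
    using nz emeasure_Int[OF sets.top] by (simp add: space_\<mu>0 emeasure_\<mu>0 space_\<mu> \<omega>\<Omega>)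
  ultimately interpret mu0: nonzero_finite_measure \<mu>0
    by (simp add: nonzero_finite_measure_def nonzero_finite_measure_axioms_def)
  interpret ray: nonzero_finite_measure ray_measure by (rule nonzero_finite_ray_measure)
  interpret measures: dual_problem_measures \<omega> rays cost \<mu>0 ray_measure
    by unfold_locales (simp_all add: sets_\<mu>0 sets_ray_measure)
  define k where "k = (if q = 0 then 1 else 1 / real DIM('a))"
  have "k > 0" by (simp add: k_def)
  have unique: "AE v in ray_measure. \<exists>u. unique_max \<phi> v u" if "continuous_on \<omega> \<phi>" for \<phi>
    using AE_not_singular[of \<phi>]
    by (rule AE_mp) (auto intro!: AE_I2 unique_max_ex[OF that] simp: space_ray_measure)
  obtain \<phi> T where \<phi>: "continuous_on \<omega> \<phi>"
    and T: "T \<in> measurable ray_measure (restrict_space borel \<omega>)"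
    and max: "AE v in ray_measure. unique_max \<phi> v (T v)"
    and sol: "density \<mu>0 (\<lambda>u. ennreal (exp (p * \<phi> u))) =
      distr (density ray_measure (\<lambda>v. ennreal (k * exp (q * ctrans \<phi> v)))) (restrict_space borel \<omega>) T"
    by (rule measures.pushforward_solution[OF \<open>p \<noteq> q\<close> \<open>k > 0\<close> unique])
  let ?A = "wulff \<phi>"
  let ?h = "\<lambda>v. ennreal (k * exp (q * ctrans \<phi> v))"
  define D where "D = distr (density ray_measure ?h) (restrict_space borel ?\<Omega>) T"
  have D: "dual_curvature_measure q C ?A = D"
    unfolding D_def k_def by (rule dual_curvature_measure_wulff[OF \<phi> T max])
  have h: "?h \<in> borel_measurable ray_measure"
    unfolding measurable_cong_sets[OF sets_ray_measure refl]
    by (intro measurable_compose[OF _ measurable_ennreal] borel_measurable_continuous_on_restrict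
        continuous_intros continuous_ctrans \<phi>)
  have "T \<in> measurable ray_measure borel" and T_omega: "\<And>v. v \<in> rays \<Longrightarrow> T v \<in> \<omega>"
    using T by (simp_all add: measurable_restrict_space2_iff space_ray_measure Pi_iff)
  then have T\<Omega>: "T \<in> measurable ray_measure (restrict_space borel ?\<Omega>)"
    using omega_subset by (intro measurable_restrict_space2) (auto simp: space_ray_measure)
  let ?f = "\<lambda>u. ennreal ((- support_fun ?A u) powr (- p))"
  have "support_fun ?A \<in> borel_measurable (restrict_space borel ?\<Omega>)"
    by (intro borel_measurable_support_fun wulff_nonempty \<phi> bdd_above_inner_wulff)
  then have f: "?f \<in> borel_measurable (restrict_space borel ?\<Omega>)" by measurable
  have "\<mu> = density D ?f"
  proof (rule measure_eqI)
    show "sets \<mu> = sets (density D ?f)" by (simp add: D_def sets_\<mu>)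
    fix \<eta> assume \<eta>\<mu>: "\<eta> \<in> sets \<mu>"
    then have \<eta>: "\<eta> \<in> sets (restrict_space borel ?\<Omega>)" by (simp add: sets_\<mu>)
    have \<eta>\<omega>: "\<eta> \<inter> \<omega> \<in> sets \<mu>0"
      unfolding \<mu>0_def sets_restrict_space using \<eta>\<mu> by (intro image_eqI[of _ _ \<eta>]) auto
    \<comment> \<open>The support function is known to equal -exp \<phi> only at values of T. The
      power of the support function is therefore exchanged for F before T is pushed forward to
      \<omega>.\<close>
    define F where "F u = ennreal (exp (- (p * \<phi> u))) * indicator \<eta> u" for u
    have F0: "(\<lambda>u. ennreal (exp (r * \<phi> u))) \<in> borel_measurable \<mu>0" for r
      unfolding measurable_cong_sets[OF sets_\<mu>0 refl]
      by (intro measurable_compose[OF _ measurable_ennreal] borel_measurable_continuous_on_restrict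
          continuous_intros \<phi>)
    have F\<mu>0: "F \<in> borel_measurable \<mu>0"
      unfolding F_def using F0[of "- p"] \<eta>\<omega>
      by (intro borel_measurable_times_ennreal) (simp_all add: borel_measurable_indicator_iff space_\<mu>0)
    then have F: "F \<in> borel_measurable (restrict_space borel \<omega>)"
      using measurable_cong_sets[OF sets_\<mu>0 refl] by blast
    have "emeasure (density D ?f) \<eta> = (\<integral>\<^sup>+ u. ?f u * indicator \<eta> u \<partial>D)"
      using f \<eta> by (intro emeasure_density) (simp_all add: D_def)
    also have "\<dots> = (\<integral>\<^sup>+ v. ?f (T v) * indicator \<eta> (T v) \<partial>density ray_measure ?h)"
      unfolding D_def using f \<eta> T\<Omega> by (subst nn_integral_distr) auto
    also have "\<dots> = (\<integral>\<^sup>+ v. F (T v) \<partial>density ray_measure ?h)"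
    proof (rule nn_integral_cong_AE)
      have "AE v in ray_measure. ?f (T v) = ennreal (exp (- (p * \<phi> (T v))))"
        using max
      proof (rule AE_mp, intro AE_I2 impI)
        fix v assume v: "v \<in> space ray_measure" and m: "unique_max \<phi> v (T v)"
        then have "support_fun ?A (T v) = - exp (\<phi> (T v))"
          using support_fun_active(2)[OF \<phi> _ _ unique_max_ctrans[OF \<phi> _ m]]
          by (simp add: space_ray_measure T_omega)
        then show "?f (T v) = ennreal (exp (- (p * \<phi> (T v))))" by (simp add: powr_def)
      qed
      then show "AE v in density ray_measure ?h. ?f (T v) * indicator \<eta> (T v) = F (T v)"
        unfolding AE_density[OF h] by (rule AE_mp) (auto intro!: AE_I2 simp: F_def)
    qed
    also have "\<dots> = (\<integral>\<^sup>+ u. F u \<partial>distr (density ray_measure ?h) (restrict_space borel \<omega>) T)"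
      using F T by (subst nn_integral_distr) auto
    also have "\<dots> = (\<integral>\<^sup>+ u. ennreal (exp (p * \<phi> u)) * F u \<partial>\<mu>0)"
      unfolding sol[symmetric] using F0 F\<mu>0 by (intro nn_integral_density)
    also have "\<dots> = (\<integral>\<^sup>+ u. indicator (\<eta> \<inter> \<omega>) u \<partial>\<mu>0)"
    proof (rule nn_integral_cong)
      fix u assume "u \<in> space \<mu>0"
      moreover have "ennreal (exp (p * \<phi> u)) * ennreal (exp (- (p * \<phi> u))) = 1"
        by (simp flip: ennreal_mult' exp_add)
      ultimately show "ennreal (exp (p * \<phi> u)) * F u = indicator (\<eta> \<inter> \<omega>) u"
        by (simp add: F_def space_\<mu>0 mult.assoc[symmetric] indicator_def)
    qed
    also have "\<dots> = emeasure \<mu> \<eta>"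
      using \<eta>\<omega> \<eta>\<mu> by (simp add: emeasure_\<mu>0 emeasure_Int)
    finally show "emeasure \<mu> \<eta> = emeasure (density D ?f) \<eta>" by simp
  qed
  then show ?thesis
    using C_full_wulff[OF \<phi>] D unfolding pq_dual_curvature_measure_def by blast
qed

end

text \<open>Each point outside the support has an open neighbourhood of measure zero, and by
  Lindelof countably many of these cover the complement.\<close>

lemma emeasure_outside_measure_support:
  fixes \<mu> :: "'a::second_countable_topology measure"
  assumes sets: "sets \<mu> = sets (restrict_space borel \<Omega>)" and "closed \<omega>" "measure_support \<mu> \<subseteq> \<omega>"
  shows "emeasure \<mu> (space \<mu> - \<omega>) = 0"
proof -
  have space: "space \<mu> = \<Omega>"
    using sets_eq_imp_space_eq[OF sets] by (simp add: space_restrict_space)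
  have open_sets: "U \<inter> \<Omega> \<in> sets \<mu>" if "open U" for U
    unfolding sets sets_restrict_space using that by (intro image_eqI[of _ _ U]) auto
  define \<U> where "\<U> = {U. open U \<and> emeasure \<mu> (U \<inter> \<Omega>) = 0}"
  obtain \<V> where \<V>: "\<V> \<subseteq> \<U>" "countable \<V>" "\<Union>\<V> = \<Union>\<U>"
    using Lindelof[of \<U>] by (auto simp: \<U>_def)
  have "(\<Union>U\<in>\<V>. U \<inter> \<Omega>) \<in> null_sets \<mu>"
    using \<V>(1) open_sets by (intro null_sets_UN' \<V>(2)) (auto simp: \<U>_def null_sets_def)
  moreover have "space \<mu> - \<omega> \<subseteq> (\<Union>U\<in>\<V>. U \<inter> \<Omega>)"
  proof
    fix x assume x: "x \<in> space \<mu> - \<omega>"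
    then have "x \<notin> measure_support \<mu>" using assms(3) by blast
    then obtain U where "open U" "x \<in> U" "emeasure \<mu> (U \<inter> \<Omega>) = 0"
      using x unfolding measure_support_def space by (auto simp: zero_less_iff_neq_zero)
    then have "x \<in> \<Union>\<V>" unfolding \<V>(3) \<U>_def by blast
    then show "x \<in> (\<Union>U\<in>\<V>. U \<inter> \<Omega>)" using x by (auto simp: space)
  qed
  ultimately show ?thesis using emeasure_eq_0[of _ \<mu>] by (meson null_setsD1 null_setsD2)
qed

theorem theorem1p1:
  fixes C :: "(real ^ 'n) set" and p q :: real
    and \<mu> :: "(real ^ 'n) measure" and \<omega> :: "(real ^ 'n) set"
  assumes "pointed_closed_convex_cone C"
    and "p \<noteq> 0"
    and "sets \<mu> = sets (restrict_space borel (Omega (polar_cone C)))"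
    and "finite_measure \<mu>"
    and "emeasure \<mu> (space \<mu>) \<noteq> 0"
    and "compact \<omega>" and "\<omega> \<subseteq> Omega (polar_cone C)"
    and "measure_support \<mu> \<subseteq> \<omega>"
  shows "(q \<noteq> 0 \<and> p \<noteq> q \<longrightarrow>
            (\<exists>A. C_full C A \<and> \<mu> = pq_dual_curvature_measure p q C A)) \<and>
         (q = 0 \<longrightarrow> (\<exists>A. C_full C A \<and> \<mu> = J_star p C A))"
proof -
  have null: "emeasure \<mu> (space \<mu> - \<omega>) = 0"
    by (rule emeasure_outside_measure_support[OF assms(3) compact_imp_closed[OF assms(6)] assms(8)])
  \<comment> \<open>An empty \<omega> would make \<mu> the zero measure.\<close>
  then have "\<omega> \<noteq> {}" using assms(5) by auto
  then interpret cone_with_directions C \<omega>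
    using assms by unfold_locales
  \<comment> \<open>Taking r = q gives the first statement; r = 0 with p distinct from 0 gives the
    second.\<close>
  have "\<exists>A. C_full C A \<and> \<mu> = pq_dual_curvature_measure p r C A" if "p \<noteq> r" for r
    using that assms(3-5) null by (rule pq_dual_Minkowski_existence)
  then show ?thesis using assms(2) unfolding J_star_def by blast
qed

end
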